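(* For $\theta\in(0,1)$, $\alpha:=\frac{1-\theta}{2}$, and every càdlàg martingale $L=(L_t)_{t\in[0,T)}$ one has $$\|\mathcal I^\alpha L\|_{\mathrm{BMO}_2([0,T))}\le 3\,\frac{\sqrt{2\alpha}}{T^\alpha}\left(\int_0^T(T-t)^{-\theta}\|L_t\|_{L_\infty}^2\,dt\right)^{1/2}.$$
   Context: Fix $T\in(0,\infty)$ and a complete probability space $(\Omega,\mathcal F,\mathbb P)$ with a right-continuous filtration $(\mathcal F_t)_{t\in[0,T]}$ such that $\mathcal F_0$ is generated by the $\mathbb P$-null sets and $\mathcal F=\mathcal F_T$. $\mathbb E^{\mathcal G}[\cdot]$ denotes (extended) conditional expectation given $\mathcal G$. For a càdlàg $K:[0,T)\to\mathbb R$ (applied path-wise to processes), $\alpha>0$ and $t\in[0,T)$, $\mathcal I^\alpha_tK:=\frac{\alpha}{T^\alpha}\int_0^T(T-u)^{\alpha-1}K_{u\wedge t}\,du$, and $\mathcal I^\alpha K:=(\mathcal I^\alpha_tK)_{t\in[0,T)}$. For an adapted càdlàg process $Y=(Y_t)_{t\in[0,T)}$, $\|Y\|_{\mathrm{BMO}_2([0,T))}$ is the infimum of all $c\in[0,\infty)$ such that $\mathbb E^{\mathcal F_\sigma}[|Y_t-Y_{\sigma-}|^2]\le c^2$ a.s. for all $t\in[0,T)$ and all stopping times $\sigma:\Omega\to[0,t]$, where $Y_{0-}:=Y_0$ and $\inf\emptyset:=\infty$. The right-hand side of the inequality may be $+\infty$. *)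

theory Defs
  imports "HOL-Probability.Probability"
begin

text \<open>
  The library notions \<^const>\<open>stopping_time\<close> and \<^const>\<open>filtration.pre_sigma\<close> need a filtration
  indexed by a whole linearly ordered type.  A filtration on \<open>[0,T]\<close> is therefore given by any
  monotone family indexed by the reals; only its members in \<open>[0,T]\<close> are constrained, and by
  \<open>stopping_time_iff\<close> and \<open>sets_pre_sigma_iff\<close> below the members outside play no role.
\<close>

locale stochastic_basis = prob_space M + complete_measure M + filtration "space M" F
  for M :: "'a measure" and F :: "real \<Rightarrow> 'a measure" +
  fixes T :: real
  assumes T_pos: "0 < T"
    and right_continuous:
      "\<And>t. 0 \<le> t \<Longrightarrow> t < T \<Longrightarrow> sets (F t) = (\<Inter>s\<in>{t<..T}. sets (F s))"
    and sets_F_0: "sets (F 0) = sigma_sets (space M) (null_sets M)"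
    and sets_F_T: "sets (F T) = sets M"
begin

lemma stopping_time_iff:
  assumes "\<And>\<omega>. \<omega> \<in> space M \<Longrightarrow> \<sigma> \<omega> \<in> {0..T}"
  shows "stopping_time F \<sigma> \<longleftrightarrow> (\<forall>s\<in>{0..T}. {\<omega>\<in>space M. \<sigma> \<omega> \<le> s} \<in> sets (F s))"
proof
  assume "stopping_time F \<sigma>"
  then show "\<forall>s\<in>{0..T}. {\<omega>\<in>space M. \<sigma> \<omega> \<le> s} \<in> sets (F s)"
    by (auto simp: stopping_time_def pred_def space_F)
next
  assume *: "\<forall>s\<in>{0..T}. {\<omega>\<in>space M. \<sigma> \<omega> \<le> s} \<in> sets (F s)"
  show "stopping_time F \<sigma>"
    unfolding stopping_time_def pred_def space_F
  proof
    fix s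
    consider "s < 0" | "0 \<le> s" "s \<le> T" | "T < s" by linarith
    then show "{\<omega>\<in>space M. \<sigma> \<omega> \<le> s} \<in> sets (F s)"
    proof cases
      case 1
      then have "{\<omega>\<in>space M. \<sigma> \<omega> \<le> s} = {}" using assms by force
      then show ?thesis by (metis sets.empty_sets)
    next
      case 2
      then show ?thesis using * by auto
    next
      case 3
      then have "{\<omega>\<in>space M. \<sigma> \<omega> \<le> s} = space (F s)" using assms space_F by force
      then show ?thesis by (metis sets.top)
    qed
  qed
qed

lemma sets_pre_sigma_iff:
  assumes \<sigma>: "stopping_time F \<sigma>" and range: "\<And>\<omega>. \<omega> \<in> space M \<Longrightarrow> \<sigma> \<omega> \<in> {0..T}"
  shows "A \<in> sets (pre_sigma \<sigma>) \<longleftrightarrow>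
    A \<in> sets M \<and> (\<forall>s\<in>{0..T}. {\<omega>\<in>A. \<sigma> \<omega> \<le> s} \<in> sets (F s))"
proof
  assume A: "A \<in> sets (pre_sigma \<sigma>)"
  then have sub: "A \<subseteq> space M"
    using sets.sets_into_space space_pre_sigma by metis
  have all: "\<And>s. {\<omega>\<in>A. \<sigma> \<omega> \<le> s} \<in> sets (F s)"
    using A \<sigma> by (auto simp: sets_pre_sigma)
  have "{\<omega>\<in>A. \<sigma> \<omega> \<le> T} = A" using sub range by force
  then show "A \<in> sets M \<and> (\<forall>s\<in>{0..T}. {\<omega>\<in>A. \<sigma> \<omega> \<le> s} \<in> sets (F s))"
    using all[of T] all sets_F_T by auto
next
  assume A: "A \<in> sets M \<and> (\<forall>s\<in>{0..T}. {\<omega>\<in>A. \<sigma> \<omega> \<le> s} \<in> sets (F s))"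
  then have sub: "A \<subseteq> space M" using sets.sets_into_space by blast
  show "A \<in> sets (pre_sigma \<sigma>)"
    unfolding sets_pre_sigma[OF \<sigma>] mem_Collect_eq
  proof
    fix s
    consider "s < 0" | "0 \<le> s" "s \<le> T" | "T < s" by linarith
    then show "{\<omega>\<in>A. \<sigma> \<omega> \<le> s} \<in> sets (F s)"
    proof cases
      case 1
      then have "{\<omega>\<in>A. \<sigma> \<omega> \<le> s} = {}" using range sub by force
      then show ?thesis by (metis sets.empty_sets)
    next
      case 2
      then show ?thesis using A by auto
    next
      case 3
      then have "{\<omega>\<in>A. \<sigma> \<omega> \<le> s} = A" using range sub by force
      then show ?thesis using A sets_F_T sets_F_mono[of T s] 3 by auto
    qed
  qed
qed

end

definition cadlag :: "real \<Rightarrow> (real \<Rightarrow> real) \<Rightarrow> bool" where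
  "cadlag T K \<longleftrightarrow>
    (\<forall>t\<in>{0..<T}. (K \<longlongrightarrow> K t) (at_right t)) \<and>
    (\<forall>t\<in>{0<..<T}. \<exists>l. (K \<longlongrightarrow> l) (at_left t))"

definition left_limit :: "(real \<Rightarrow> real) \<Rightarrow> real \<Rightarrow> real" where
  "left_limit K t = (if t = 0 then K 0 else Lim (at_left t) K)"

definition adapted :: "(real \<Rightarrow> 'a measure) \<Rightarrow> real \<Rightarrow> (real \<Rightarrow> 'a \<Rightarrow> real) \<Rightarrow> bool" where
  "adapted F T Y \<longleftrightarrow> (\<forall>t\<in>{0..<T}. Y t \<in> borel_measurable (F t))"

definition martingale ::
  "'a measure \<Rightarrow> (real \<Rightarrow> 'a measure) \<Rightarrow> real \<Rightarrow> (real \<Rightarrow> 'a \<Rightarrow> real) \<Rightarrow> bool" where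
  "martingale M F T L \<longleftrightarrow>
    adapted F T L \<and> (\<forall>t\<in>{0..<T}. integrable M (L t)) \<and>
    (\<forall>s t. 0 \<le> s \<and> s \<le> t \<and> t < T \<longrightarrow> (AE \<omega> in M. real_cond_exp M (F s) (L t) \<omega> = L s \<omega>))"

definition cadlag_martingale ::
  "'a measure \<Rightarrow> (real \<Rightarrow> 'a measure) \<Rightarrow> real \<Rightarrow> (real \<Rightarrow> 'a \<Rightarrow> real) \<Rightarrow> bool" where
  "cadlag_martingale M F T L \<longleftrightarrow>
    martingale M F T L \<and> (\<forall>\<omega>\<in>space M. cadlag T (\<lambda>t. L t \<omega>))"

definition frac_int :: "real \<Rightarrow> real \<Rightarrow> (real \<Rightarrow> real) \<Rightarrow> real \<Rightarrow> real" where
  "frac_int T \<alpha> K t =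
    \<alpha> / T powr \<alpha> * (LBINT u:{0..T}. (T - u) powr (\<alpha> - 1) * K (min u t))"

definition frac_int_process ::
  "real \<Rightarrow> real \<Rightarrow> (real \<Rightarrow> 'a \<Rightarrow> real) \<Rightarrow> real \<Rightarrow> 'a \<Rightarrow> real" where
  "frac_int_process T \<alpha> Y t \<omega> = frac_int T \<alpha> (\<lambda>u. Y u \<omega>) t"

text \<open>
  The following is meant for adapted processes all of whose paths are cadlag: then the
  left limits exist and the integrand below is measurable.  (On non-measurable functions
  \<^const>\<open>nn_cond_exp\<close> is zero by convention.)  The infimum is taken in \<open>[0,\<infinity>]\<close>, where
  \<open>Inf {} = \<infinity>\<close>.
\<close>

definition BMO2_norm ::
  "'a measure \<Rightarrow> (real \<Rightarrow> 'a measure) \<Rightarrow> real \<Rightarrow> (real \<Rightarrow> 'a \<Rightarrow> real) \<Rightarrow> ennreal" where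
  "BMO2_norm M F T Y =
    Inf {ennreal c | c. 0 \<le> c \<and>
      (\<forall>t\<in>{0..<T}. \<forall>\<sigma>. stopping_time F \<sigma> \<and> (\<forall>\<omega>\<in>space M. \<sigma> \<omega> \<in> {0..t}) \<longrightarrow>
        (AE \<omega> in M.
          nn_cond_exp M (filtration.pre_sigma (space M) F \<sigma>)
            (\<lambda>\<omega>. ennreal (\<bar>Y t \<omega> - left_limit (\<lambda>s. Y s \<omega>) (\<sigma> \<omega>)\<bar>\<^sup>2)) \<omega>
          \<le> ennreal (c\<^sup>2)))}"

definition Linf_norm :: "'a measure \<Rightarrow> ('a \<Rightarrow> real) \<Rightarrow> ennreal" where
  "Linf_norm M f = esssup M (\<lambda>\<omega>. ennreal \<bar>f \<omega>\<bar>)"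

definition ennreal_sqrt :: "ennreal \<Rightarrow> ennreal" where
  "ennreal_sqrt x = (if x = \<infinity> then \<infinity> else ennreal (sqrt (enn2real x)))"

end

theory Submission
  imports Defs
begin

text \<open>
  For a stopping time \<open>\<sigma> \<le> t\<close> the jump \<open>Y\<^sub>t - Y\<^bsub>\<sigma>-\<^esub>\<close> of \<open>Y = I\<^sup>\<alpha> L\<close> equals
  \<open>\<alpha> / T\<^sup>\<alpha>\<close> times the integral of \<open>(T - u)\<^bsup>\<alpha>-1\<^esup> Z\<^sub>u\<close> over \<open>[0, T]\<close>, where
  \<open>Z\<^sub>u = L\<^bsub>min u t\<^esub> - L\<^bsub>\<sigma>-\<^esub>\<close> if \<open>\<sigma> \<le> u\<close> and \<open>Z\<^sub>u = 0\<close> otherwise.  For \<open>A\<close> in the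
  \<open>\<sigma>\<close>-algebra of the stopping time and \<open>u \<le> v\<close>, the martingale property gives
  \<open>E[1\<^sub>A Z\<^sub>u Z\<^sub>v] = E[1\<^sub>A Z\<^sub>u\<^sup>2]\<close>.  Expanding the square of the integral and integrating out the
  larger time variable bounds \<open>E[1\<^sub>A (Y\<^sub>t - Y\<^bsub>\<sigma>-\<^esub>)\<^sup>2]\<close> by \<open>2 \<alpha> / T\<^bsup>2\<alpha>\<^esup>\<close> times the integral of
  \<open>(T - u)\<^bsup>2\<alpha>-1\<^esup> E[1\<^sub>A Z\<^sub>u\<^sup>2]\<close>, and \<open>\<bar>Z\<^sub>u\<bar>\<close> is almost surely at most twice the essential supremum
  of \<open>L\<^sub>u\<close>.  This yields the constant 2 in place of 3.
\<close>

section \<open>Conditional expectations and second moments of integrals\<close>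

text \<open>The hypothesis is tested on the set \<open>A\<close> where the conditional expectation
  exceeds \<open>c\<close>. The excess over \<open>c\<close> then has integral zero on
  \<open>A\<close>. Finiteness of \<open>c\<close> and of the measure permits the subtraction in
  \<open>ennreal\<close>.\<close>

lemma (in finite_measure_subalgebra) nn_cond_exp_le_const:
  assumes [measurable]: "f \<in> borel_measurable M"
    and c: "c < \<infinity>"
    and le: "\<And>A. A \<in> sets F \<Longrightarrow> (\<integral>\<^sup>+x. indicator A x * f x \<partial>M) \<le> c * emeasure M A"
  shows "AE x in M. nn_cond_exp M F f x \<le> c"
proof -
  let ?g = "nn_cond_exp M F f"
  define A where "A = {x \<in> space M. c < ?g x}"
  have "space F = space M" using subalg by (simp add: subalgebra_def)
  have "{x \<in> space F. c < ?g x} \<in> sets F" by measurable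
  then have A[measurable]: "A \<in> sets F" by (simp add: A_def \<open>space F = space M\<close>)
  have [measurable]: "A \<in> sets M" using A subalg by (auto simp: subalgebra_def)
  have [measurable]: "?g \<in> borel_measurable M" by simp
  have fin: "(\<integral>\<^sup>+x. c * indicator A x \<partial>M) \<noteq> \<infinity>"
    using c by (simp add: nn_integral_cmult ennreal_mult_eq_top_iff)
  have "(\<integral>\<^sup>+x. indicator A x * ?g x \<partial>M) = (\<integral>\<^sup>+x. indicator A x * f x \<partial>M)"
    by (rule nn_cond_exp_intg) auto
  also have "\<dots> \<le> (\<integral>\<^sup>+x. c * indicator A x \<partial>M)"
    using le[OF A] by (simp add: nn_integral_cmult)
  finally have "(\<integral>\<^sup>+x. indicator A x * ?g x \<partial>M) - (\<integral>\<^sup>+x. c * indicator A x \<partial>M) = 0"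
    using fin by (intro diff_eq_0_ennreal) (auto simp: less_top dest: neq_top_trans)
  moreover have "(\<integral>\<^sup>+x. indicator A x * ?g x - c * indicator A x \<partial>M)
      = (\<integral>\<^sup>+x. indicator A x * ?g x \<partial>M) - (\<integral>\<^sup>+x. c * indicator A x \<partial>M)"
    by (rule nn_integral_diff) (use fin in \<open>auto simp: A_def indicator_def\<close>)
  ultimately have "(\<integral>\<^sup>+x. indicator A x * ?g x - c * indicator A x \<partial>M) = 0" by simp
  then have "AE x in M. indicator A x * ?g x - c * indicator A x = 0"
    by (subst (asm) nn_integral_0_iff_AE) auto
  with AE_space show ?thesis
  proof eventually_elim
    case (elim x)
    then show ?case
      by (cases "x \<in> A") (auto simp: A_def diff_eq_0_iff_ennreal)
  qed
qed

text \<open>One factor of the square is moved under the integral over \<open>N\<close> and Fubini is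
  applied, then the same is done with the other factor. The uniform bound \<open>B\<close> on finite
  measures supplies integrability each time.\<close>

lemma second_moment_integral:
  fixes Z :: "'b \<Rightarrow> 'a \<Rightarrow> real"
  assumes N: "finite_measure N" and M: "finite_measure M"
    and Z[measurable]: "case_prod Z \<in> borel_measurable (N \<Otimes>\<^sub>M M)"
    and B: "\<And>u \<omega>. u \<in> space N \<Longrightarrow> \<omega> \<in> space M \<Longrightarrow> \<bar>Z u \<omega>\<bar> \<le> B"
  shows "(\<integral>\<omega>. (\<integral>u. Z u \<omega> \<partial>N)\<^sup>2 \<partial>M) = (\<integral>u. (\<integral>v. (\<integral>\<omega>. Z u \<omega> * Z v \<omega> \<partial>M) \<partial>N) \<partial>N)"
    and "integrable M (\<lambda>\<omega>. (\<integral>u. Z u \<omega> \<partial>N)\<^sup>2)"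
proof -
  interpret N: finite_measure N by fact
  interpret M: finite_measure M by fact
  interpret P: pair_sigma_finite N M ..
  have [measurable]: "(\<lambda>u. Z u \<omega>) \<in> borel_measurable N" if "\<omega> \<in> space M" for \<omega>
    using that by measurable
  have [measurable]: "Z u \<in> borel_measurable M" if "u \<in> space N" for u
    using that by measurable
  have fNM: "finite_measure (N \<Otimes>\<^sub>M M)"
    by (intro finite_measureI) (simp add: M.emeasure_pair_measure_Times space_pair_measure ennreal_mult_eq_top_iff)
  interpret NM: finite_measure "N \<Otimes>\<^sub>M M" by (rule fNM)
  define G where "G \<omega> = (\<integral>u. Z u \<omega> \<partial>N)" for \<omega>
  have G[measurable]: "G \<in> borel_measurable M"
    unfolding G_def by (rule N.borel_measurable_lebesgue_integral) measurable
  have iZ: "integrable N (\<lambda>u. Z u \<omega>)" if "\<omega> \<in> space M" for \<omega>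
    by (rule N.integrable_const_bound[where B=B]) (use that B in auto)
  have "\<bar>G \<omega>\<bar> \<le> (\<integral>u. B \<partial>N)" if w: "\<omega> \<in> space M" for \<omega>
  proof -
    have "\<bar>G \<omega>\<bar> \<le> (\<integral>u. \<bar>Z u \<omega>\<bar> \<partial>N)" unfolding G_def by (rule integral_abs_bound)
    also have "\<dots> \<le> (\<integral>u. B \<partial>N)" by (intro integral_mono integrable_abs iZ w) (use B w in auto)
    finally show ?thesis .
  qed
  then obtain B' where B': "\<And>\<omega>. \<omega> \<in> space M \<Longrightarrow> \<bar>G \<omega>\<bar> \<le> B'" by blast
  have "integrable M (\<lambda>\<omega>. (G \<omega>)\<^sup>2)"
  proof (rule M.integrable_const_bound[where B="B'\<^sup>2"])
    show "AE \<omega> in M. norm ((G \<omega>)\<^sup>2) \<le> B'\<^sup>2"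
      using power_mono[OF B' abs_ge_zero, of _ 2] by (intro AE_I2) simp
  qed measurable
  then show "integrable M (\<lambda>\<omega>. (\<integral>u. Z u \<omega> \<partial>N)\<^sup>2)" by (simp only: G_def)
  have "(\<integral>\<omega>. (G \<omega>)\<^sup>2 \<partial>M) = (\<integral>\<omega>. (\<integral>u. Z u \<omega> * G \<omega> \<partial>N) \<partial>M)"
    by (simp only: G_def power2_eq_square integral_mult_left_zero)
  also have "\<dots> = (\<integral>u. (\<integral>\<omega>. Z u \<omega> * G \<omega> \<partial>M) \<partial>N)"
  proof (rule P.Fubini_integral)
    show "integrable (N \<Otimes>\<^sub>M M) (\<lambda>(u, \<omega>). Z u \<omega> * G \<omega>)"
    proof (rule NM.integrable_const_bound[where B="B * B'"])
      show "AE x in N \<Otimes>\<^sub>M M. norm (case x of (u, \<omega>) \<Rightarrow> Z u \<omega> * G \<omega>) \<le> B * B'"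
        using B B' by (intro AE_I2) (auto simp: space_pair_measure abs_mult intro!: mult_mono' )
    qed measurable
  qed
  also have "\<dots> = (\<integral>u. (\<integral>v. (\<integral>\<omega>. Z u \<omega> * Z v \<omega> \<partial>M) \<partial>N) \<partial>N)"
  proof (rule Bochner_Integration.integral_cong[OF refl])
    fix u assume u: "u \<in> space N"
    have "(\<integral>\<omega>. Z u \<omega> * G \<omega> \<partial>M) = (\<integral>\<omega>. (\<integral>v. Z u \<omega> * Z v \<omega> \<partial>N) \<partial>M)"
      by (simp only: G_def integral_mult_right_zero)
    also have "\<dots> = (\<integral>v. (\<integral>\<omega>. Z u \<omega> * Z v \<omega> \<partial>M) \<partial>N)"
    proof (rule P.Fubini_integral)
      show "integrable (N \<Otimes>\<^sub>M M) (\<lambda>(v, \<omega>). Z u \<omega> * Z v \<omega>)"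
      proof (rule NM.integrable_const_bound[where B="B * B"])
        show "AE x in N \<Otimes>\<^sub>M M. norm (case x of (v, \<omega>) \<Rightarrow> Z u \<omega> * Z v \<omega>) \<le> B * B"
          using B u by (intro AE_I2) (auto simp: space_pair_measure abs_mult intro!: mult_mono' )
      qed (use u in measurable)
    qed
    finally show "(\<integral>\<omega>. Z u \<omega> * G \<omega> \<partial>M) = \<dots>" .
  qed
  finally show "(\<integral>\<omega>. (\<integral>u. Z u \<omega> \<partial>N)\<^sup>2 \<partial>M) = (\<integral>u. (\<integral>v. (\<integral>\<omega>. Z u \<omega> * Z v \<omega> \<partial>M) \<partial>N) \<partial>N)"
    by (simp only: G_def)
qed

text \<open>By \<open>orth\<close> the mixed moment at (u, v) is the second moment at the smaller
  time. The regions u \<le> v and v \<le> u contribute equally, which gives the factor 2. On the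
  first of them the larger variable integrates to the tail mass
  \<open>measure N {u..}\<close>.\<close>

lemma second_moment_orthogonal_le:
  fixes Z :: "real \<Rightarrow> 'a \<Rightarrow> real"
  assumes N: "finite_measure N" and [measurable_cong]: "sets N = sets borel" and M: "finite_measure M"
    and Z[measurable]: "case_prod Z \<in> borel_measurable (N \<Otimes>\<^sub>M M)"
    and B: "\<And>u \<omega>. \<omega> \<in> space M \<Longrightarrow> \<bar>Z u \<omega>\<bar> \<le> B"
    and orth: "\<And>u v. u \<le> v \<Longrightarrow> (\<integral>\<omega>. Z u \<omega> * Z v \<omega> \<partial>M) = (\<integral>\<omega>. (Z u \<omega>)\<^sup>2 \<partial>M)"
  shows "(\<integral>\<omega>. (\<integral>u. Z u \<omega> \<partial>N)\<^sup>2 \<partial>M) \<le> 2 * (\<integral>u. (\<integral>\<omega>. (Z u \<omega>)\<^sup>2 \<partial>M) * measure N {u..} \<partial>N)"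
    and "integrable N (\<lambda>u. (\<integral>\<omega>. (Z u \<omega>)\<^sup>2 \<partial>M) * measure N {u..})"
proof -
  interpret N: finite_measure N by fact
  interpret M: finite_measure M by fact
  interpret NN: pair_sigma_finite N N ..
  have spN: "space N = UNIV" using assms(2) sets_eq_imp_space_eq by fastforce
  have [measurable]: "Z u \<in> borel_measurable M" for u
    using measurable_compose[OF measurable_Pair1' Z, of u] by (simp add: spN)
  define \<Phi> where "\<Phi> u = (\<integral>\<omega>. (Z u \<omega>)\<^sup>2 \<partial>M)" for u
  have [measurable]: "\<Phi> \<in> borel_measurable N"
    unfolding \<Phi>_def by (rule M.borel_measurable_lebesgue_integral) measurable
  have \<Phi>0: "0 \<le> \<Phi> u" for u by (simp add: \<Phi>_def)
  have ZZ: "\<bar>Z u \<omega> * Z v \<omega>\<bar> \<le> B * B" if "\<omega> \<in> space M" for u v \<omega>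
    using B[OF that] by (auto simp: abs_mult intro!: mult_mono')
  have iZZ: "integrable M (\<lambda>\<omega>. Z u \<omega> * Z v \<omega>)" for u v
    by (rule M.integrable_const_bound[where B="B * B"]) (use ZZ in auto)
  define C where "C = (\<integral>\<omega>. B * B \<partial>M)"
  have eC: "\<bar>\<integral>\<omega>. Z u \<omega> * Z v \<omega> \<partial>M\<bar> \<le> C" for u v
  proof -
    have "\<bar>\<integral>\<omega>. Z u \<omega> * Z v \<omega> \<partial>M\<bar> \<le> (\<integral>\<omega>. \<bar>Z u \<omega> * Z v \<omega>\<bar> \<partial>M)" by (rule integral_abs_bound)
    also have "\<dots> \<le> C" unfolding C_def
      by (intro integral_mono integrable_abs iZZ) (use ZZ in auto)
    finally show ?thesis .
  qed
  have \<Phi>C: "\<Phi> u \<le> C" for u using eC[of u u] \<Phi>0[of u] by (simp add: \<Phi>_def power2_eq_square)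
  have fNN: "finite_measure (N \<Otimes>\<^sub>M N)"
    by (intro finite_measureI) (simp add: N.emeasure_pair_measure_Times space_pair_measure ennreal_mult_eq_top_iff)
  interpret NN: finite_measure "N \<Otimes>\<^sub>M N" by (rule fNN)
  have bnd: "norm (\<Phi> x * indicator {x..} y) \<le> C" for x y
    using \<Phi>0[of x] \<Phi>C[of x] by (auto simp: indicator_def)
  have [measurable]: "(\<lambda>p. indicator {fst p..} (snd p) :: real) \<in> borel_measurable (N \<Otimes>\<^sub>M N)"
  proof -
    have "(\<lambda>p. indicator {fst p..} (snd p) :: real) = indicator {p\<in>space (N \<Otimes>\<^sub>M N). fst p \<le> snd p}"
      by (auto simp: indicator_def fun_eq_iff space_pair_measure spN)
    also have "\<dots> \<in> borel_measurable (N \<Otimes>\<^sub>M N)" by measurable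
    finally show ?thesis .
  qed
  have i2: "integrable (N \<Otimes>\<^sub>M N) (\<lambda>(x, y). \<Phi> x * indicator {x..} y)"
    by (rule NN.integrable_const_bound[where B=C]) (use bnd in \<open>auto simp: split_beta'\<close>)
  have i2': "integrable (N \<Otimes>\<^sub>M N) (\<lambda>(x, y). \<Phi> y * indicator {y..} x)"
    using NN.integrable_product_swap[OF i2] by (simp add: split_beta')
  have iv: "integrable N (\<lambda>y. \<Phi> x * indicator {x..} y)" for x
    by (rule N.integrable_const_bound[where B=C]) (use bnd in auto)
  have [measurable]: "(\<lambda>y. indicator {y..} x :: real) \<in> borel_measurable N" for x
  proof -
    have "(\<lambda>y. indicator {y..} x :: real) = indicator {..x}" by (auto simp: indicator_def)
    then show ?thesis by simp
  qed
  have iv': "integrable N (\<lambda>y. \<Phi> y * indicator {y..} x)" for x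
    by (rule N.integrable_const_bound[where B=C]) (use bnd in auto)
  have val: "(\<integral>y. \<Phi> x * indicator {x..} y \<partial>N) = \<Phi> x * measure N {x..}" for x
    by (simp add: spN)
  have i1: "integrable N (\<lambda>x. \<Phi> x * measure N {x..})"
    using NN.integrable_fst[OF i2] by (simp add: spN)
  then show "integrable N (\<lambda>u. (\<integral>\<omega>. (Z u \<omega>)\<^sup>2 \<partial>M) * measure N {u..})" by (simp add: \<Phi>_def)
  have [measurable]: "(\<lambda>p. \<integral>\<omega>. Z (fst p) \<omega> * Z (snd p) \<omega> \<partial>M) \<in> borel_measurable (N \<Otimes>\<^sub>M N)"
    by (rule M.borel_measurable_lebesgue_integral) measurable
  have ie2: "integrable (N \<Otimes>\<^sub>M N) (\<lambda>(u,v). \<integral>\<omega>. Z u \<omega> * Z v \<omega> \<partial>M)"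
    by (rule NN.integrable_const_bound[where B=C]) (use eC in \<open>auto simp: split_beta'\<close>)
  have ie: "integrable N (\<lambda>v. \<integral>\<omega>. Z u \<omega> * Z v \<omega> \<partial>M)" for u
  proof (rule N.integrable_const_bound[where B=C])
    show "(\<lambda>v. \<integral>\<omega>. Z u \<omega> * Z v \<omega> \<partial>M) \<in> borel_measurable N"
      by (rule M.borel_measurable_lebesgue_integral) measurable
  qed (use eC in auto)
  \<comment> \<open>The diagonal lies in both regions and is counted twice. \<open>N\<close> may
    have atoms, so only an inequality is claimed, and it holds because \<open>\<Phi>\<close> is
    nonnegative.\<close>
  have le: "(\<integral>\<omega>. Z u \<omega> * Z v \<omega> \<partial>M) \<le> \<Phi> u * indicator {u..} v + \<Phi> v * indicator {v..} u" for u v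
  proof (cases "u \<le> v")
    case True
    then show ?thesis using orth[OF True] \<Phi>0[of v] by (simp add: \<Phi>_def indicator_def)
  next
    case False
    then show ?thesis using orth[of v u] by (simp add: \<Phi>_def indicator_def mult.commute)
  qed
  have "(\<integral>\<omega>. (\<integral>u. Z u \<omega> \<partial>N)\<^sup>2 \<partial>M) = (\<integral>u. (\<integral>v. (\<integral>\<omega>. Z u \<omega> * Z v \<omega> \<partial>M) \<partial>N) \<partial>N)"
    by (rule second_moment_integral(1)[OF N M Z]) (use B in auto)
  also have "\<dots> \<le> (\<integral>u. (\<integral>v. \<Phi> u * indicator {u..} v + \<Phi> v * indicator {v..} u \<partial>N) \<partial>N)"
  proof (intro integral_mono ie le Bochner_Integration.integrable_add iv iv')
    show "integrable N (\<lambda>u. \<integral>v. \<Phi> u * indicator {u..} v + \<Phi> v * indicator {v..} u \<partial>N)"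
      unfolding Bochner_Integration.integral_add[OF iv iv']
      using NN.integrable_fst[OF i2] NN.integrable_fst[OF i2'] by (intro Bochner_Integration.integrable_add)
  qed (use NN.integrable_fst[OF ie2] in simp)
  also have "\<dots> = (\<integral>u. (\<integral>v. \<Phi> u * indicator {u..} v \<partial>N) + (\<integral>v. \<Phi> v * indicator {v..} u \<partial>N) \<partial>N)"
    by (simp only: Bochner_Integration.integral_add[OF iv iv'])
  also have "\<dots> = (\<integral>u. (\<integral>v. \<Phi> u * indicator {u..} v \<partial>N) \<partial>N) + (\<integral>u. (\<integral>v. \<Phi> v * indicator {v..} u \<partial>N) \<partial>N)"
    using NN.integrable_fst[OF i2] NN.integrable_fst[OF i2'] by (intro Bochner_Integration.integral_add) auto
  \<comment> \<open>Exchanging the order of integration turns the second region into the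
    first.\<close>
  also have "(\<integral>u. (\<integral>v. \<Phi> v * indicator {v..} u \<partial>N) \<partial>N) = (\<integral>v. (\<integral>u. \<Phi> v * indicator {v..} u \<partial>N) \<partial>N)"
    by (rule NN.Fubini_integral[OF i2])
  finally show "(\<integral>\<omega>. (\<integral>u. Z u \<omega> \<partial>N)\<^sup>2 \<partial>M) \<le> 2 * (\<integral>u. (\<integral>\<omega>. (Z u \<omega>)\<^sup>2 \<partial>M) * measure N {u..} \<partial>N)"
    by (simp only: val) (simp add: \<Phi>_def)
qed

section \<open>The weight of the fractional integral as a measure\<close>

text \<open>The reflection v -> T - v moves the possible singularity from T to 0, where the
  antiderivative of a power is available.\<close>

lemma nn_integral_powr_tail:
  assumes "0 < \<alpha>" "u \<le> T"
  shows "(\<integral>\<^sup>+v\<in>{u..T}. ennreal ((T - v) powr (\<alpha> - 1)) \<partial>lborel) = ennreal ((T - u) powr \<alpha> / \<alpha>)"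
proof -
  let ?f = "\<lambda>x::real. ennreal (x powr (\<alpha> - 1)) * indicator {0..T - u} x"
  have "(\<integral>\<^sup>+v\<in>{u..T}. ennreal ((T - v) powr (\<alpha> - 1)) \<partial>lborel) = (\<integral>\<^sup>+v. ?f (T + (-1) * v) \<partial>lborel)"
    by (intro nn_integral_cong) (auto simp: indicator_def)
  also have "\<dots> = (\<integral>\<^sup>+x. ?f x \<partial>lborel)"
    by (subst nn_integral_real_affine[of _ "-1" T]) auto
  also have "\<dots> = (\<integral>\<^sup>+x. ennreal (if x \<in> {0..T - u} then x powr (\<alpha> - 1) else 0) \<partial>lborel)"
    by (intro nn_integral_cong) (auto simp: indicator_def)
  also have "\<dots> = ennreal ((T - u) powr \<alpha> / \<alpha>)"
  proof (rule nn_integral_has_integral_lborel)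
    have "((\<lambda>x. x powr (\<alpha> - 1)) has_integral ((T - u) powr (\<alpha> - 1 + 1) / (\<alpha> - 1 + 1))) {0..T - u}"
      by (rule has_integral_powr_from_0) (use assms in auto)
    then show "((\<lambda>x. if x \<in> {0..T - u} then x powr (\<alpha> - 1) else 0) has_integral (T - u) powr \<alpha> / \<alpha>) UNIV"
      by (subst has_integral_restrict_UNIV) simp
  qed auto
  finally show ?thesis .
qed

text \<open>With the weight as a measure, a fractional integral becomes a plain integral, to which
  \<open>second_moment_orthogonal_le\<close> applies. The indicator sits inside the density, so that
  the measure lives on the whole Borel line while being carried by [0, T].\<close>

definition powr_measure :: "real \<Rightarrow> real \<Rightarrow> real measure" where
  "powr_measure T \<alpha> = density lborel (\<lambda>u. ennreal (indicator {0..T} u * (T - u) powr (\<alpha> - 1)))"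

lemma emeasure_powr_measure:
  assumes "0 < \<alpha>" "0 \<le> u" "u \<le> T"
  shows "emeasure (powr_measure T \<alpha>) {u..} = ennreal ((T - u) powr \<alpha> / \<alpha>)"
proof -
  have "emeasure (powr_measure T \<alpha>) {u..}
      = (\<integral>\<^sup>+v. ennreal (indicator {0..T} v * (T - v) powr (\<alpha> - 1)) * indicator {u..} v \<partial>lborel)"
    unfolding powr_measure_def by (subst emeasure_density) auto
  also have "\<dots> = (\<integral>\<^sup>+v\<in>{u..T}. ennreal ((T - v) powr (\<alpha> - 1)) \<partial>lborel)"
    using assms by (intro nn_integral_cong) (auto simp: indicator_def)
  finally show ?thesis using assms by (simp add: nn_integral_powr_tail)
qed

lemma measure_powr_measure:
  assumes "0 < \<alpha>" "0 \<le> u" "u \<le> T"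
  shows "measure (powr_measure T \<alpha>) {u..} = (T - u) powr \<alpha> / \<alpha>"
  using emeasure_powr_measure[OF assms] assms by (simp add: measure_def)

lemma finite_powr_measure:
  assumes "0 < \<alpha>" "0 < T"
  shows "finite_measure (powr_measure T \<alpha>)"
proof (rule finite_measureI)
  have "emeasure (powr_measure T \<alpha>) (space (powr_measure T \<alpha>))
      = (\<integral>\<^sup>+v. ennreal (indicator {0..T} v * (T - v) powr (\<alpha> - 1)) \<partial>lborel)"
    unfolding powr_measure_def by (subst emeasure_density) auto
  also have "\<dots> = (\<integral>\<^sup>+v\<in>{0..T}. ennreal ((T - v) powr (\<alpha> - 1)) \<partial>lborel)"
    by (intro nn_integral_cong) (auto simp: indicator_def)
  finally show "emeasure (powr_measure T \<alpha>) (space (powr_measure T \<alpha>)) \<noteq> \<infinity>"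
    using assms by (simp add: nn_integral_powr_tail)
qed

section \<open>Cadlag paths: left limits, measurability, fractional integrals\<close>

lemma tendsto_left_limit:
  assumes "cadlag T K" "0 < s" "s < T"
  shows "(K \<longlongrightarrow> left_limit K s) (at_left s)"
proof -
  have "s \<in> {0<..<T}" using assms by simp
  then obtain l where l: "(K \<longlongrightarrow> l) (at_left s)"
    using assms(1) unfolding cadlag_def by blast
  then have "Lim (at_left s) K = l" by (intro tendsto_Lim) auto
  then show ?thesis using l assms by (simp add: left_limit_def)
qed

text \<open>The separate bound on \<open>K 0\<close> serves s = 0, where no earlier time exists and
  the left limit is \<open>K 0\<close> by convention.\<close>

lemma abs_left_limit_le:
  assumes K: "cadlag T K" and s: "0 \<le> s" "s < T" and "\<bar>K 0\<bar> \<le> C"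
    and le: "\<And>r. 0 \<le> r \<Longrightarrow> r < s \<Longrightarrow> \<bar>K r\<bar> \<le> C"
  shows "\<bar>left_limit K s\<bar> \<le> C"
proof (cases "s = 0")
  case True
  then show ?thesis using assms by (simp add: left_limit_def)
next
  case False
  then have "0 < s" using s by simp
  have "((\<lambda>r. \<bar>K r\<bar>) \<longlongrightarrow> \<bar>left_limit K s\<bar>) (at_left s)"
    by (intro tendsto_rabs tendsto_left_limit[OF K \<open>0 < s\<close> s(2)])
  moreover have "eventually (\<lambda>r. \<bar>K r\<bar> \<le> C) (at_left s)"
    using eventually_at_left_real[OF \<open>0 < s\<close>] by eventually_elim (auto intro: le)
  ultimately show ?thesis by (intro tendsto_upperbound) auto
qed

text \<open>Floor plus one, rather than the ceiling, keeps the grid point of mesh 1 / (n + 1)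
  strictly to the right of u, as convergence along \<open>at_right u\<close> demands.\<close>

lemma less_grid_right:
  fixes u :: real
  shows "u < (of_int \<lfloor>real (Suc n) * u\<rfloor> + 1) / real (Suc n)"
proof -
  have "u * real (Suc n) < of_int \<lfloor>real (Suc n) * u\<rfloor> + 1"
    by (subst mult.commute) linarith
  then show ?thesis by (subst pos_less_divide_eq) simp_all
qed

lemma tendsto_grid_right:
  fixes u :: real
  shows "(\<lambda>n. (of_int \<lfloor>real (Suc n) * u\<rfloor> + 1) / real (Suc n)) \<longlonglongrightarrow> u"
proof (rule tendsto_sandwich)
  show "(\<lambda>n. u) \<longlonglongrightarrow> u" "(\<lambda>n. u + inverse (real (Suc n))) \<longlonglongrightarrow> u"
    by (rule tendsto_const, rule LIMSEQ_inverse_real_of_nat_add)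
  show "\<forall>\<^sub>F n in sequentially. u \<le> (of_int \<lfloor>real (Suc n) * u\<rfloor> + 1) / real (Suc n)"
    by (intro always_eventually allI less_imp_le less_grid_right)
  show "\<forall>\<^sub>F n in sequentially. (of_int \<lfloor>real (Suc n) * u\<rfloor> + 1) / real (Suc n) \<le> u + inverse (real (Suc n))"
  proof (intro always_eventually allI)
    fix n
    have "of_int \<lfloor>real (Suc n) * u\<rfloor> + 1 \<le> real (Suc n) * u + 1" by linarith
    from divide_right_mono[OF this, of "real (Suc n)"]
    show "(of_int \<lfloor>real (Suc n) * u\<rfloor> + 1) / real (Suc n) \<le> u + inverse (real (Suc n))"
      by (simp add: add_divide_distrib inverse_eq_divide del: of_nat_Suc)
  qed
qed

text \<open>Right continuity makes the process a limit of its values at the next grid point to the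
  right. Each approximation uses only countably many times and is therefore jointly measurable.
  Clamping to [0, t] keeps to times at which \<open>L\<close> is known to be measurable.\<close>

lemma cadlag_measurable_pair:
  fixes L :: "real \<Rightarrow> 'a \<Rightarrow> real"
  assumes t: "0 \<le> t" "t < T"
    and L: "\<And>s. 0 \<le> s \<Longrightarrow> s \<le> t \<Longrightarrow> L s \<in> borel_measurable N"
    and cad: "\<And>\<omega>. \<omega> \<in> space N \<Longrightarrow> cadlag T (\<lambda>s. L s \<omega>)"
  shows "(\<lambda>(u, \<omega>). L (max 0 (min u t)) \<omega>) \<in> borel_measurable (borel \<Otimes>\<^sub>M N)"
proof -
  define q where "q n i = max 0 (min t ((of_int i + 1) / real (Suc n)))" for n and i :: int
  have lim: "(\<lambda>n. L (q n \<lfloor>real (Suc n) * u\<rfloor>) \<omega>) \<longlonglongrightarrow> L (max 0 (min u t)) \<omega>"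
    if \<omega>: "\<omega> \<in> space N" for u \<omega>
  proof -
    let ?q = "\<lambda>n. q n \<lfloor>real (Suc n) * u\<rfloor>"
    consider "u < 0" | "t \<le> u" | "0 \<le> u" "u < t" by linarith
    then show ?thesis
    proof cases
      case 1
      have "?q n = max 0 (min u t)" for n
      proof -
        have "real (Suc n) * u < 0" using 1 by (simp add: mult_less_0_iff)
        then have "\<lfloor>real (Suc n) * u\<rfloor> + 1 \<le> 0" by (simp only: floor_less_zero add1_zle_eq)
        then have "real_of_int (\<lfloor>real (Suc n) * u\<rfloor> + 1) \<le> 0" by (simp only: of_int_le_0_iff)
        then have "(of_int \<lfloor>real (Suc n) * u\<rfloor> + 1) / real (Suc n) \<le> 0" by (simp add: divide_le_0_iff del: of_nat_Suc)
        then show ?thesis using 1 t by (simp add: q_def)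
      qed
      then show ?thesis by simp
    next
      case 2
      have "?q n = max 0 (min u t)" for n
        using 2 t less_grid_right[of u n] by (simp add: q_def)
      then show ?thesis by simp
    next
      case 3
      have "?q \<longlonglongrightarrow> max 0 (min t u)"
        unfolding q_def by (intro tendsto_max tendsto_min tendsto_const tendsto_grid_right)
      moreover have "u < ?q n" for n
        using 3 less_grid_right[of u n] by (simp add: q_def)
      ultimately have "filterlim ?q (at_right u) sequentially"
        using 3 by (auto simp: filterlim_at less_imp_neq[THEN not_sym])
      moreover have "((\<lambda>s. L s \<omega>) \<longlongrightarrow> L u \<omega>) (at_right u)"
        using cad[OF \<omega>] 3 t by (auto simp: cadlag_def)
      ultimately have "(\<lambda>n. L (?q n) \<omega>) \<longlonglongrightarrow> L u \<omega>"
        by (rule filterlim_compose[rotated])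
      then show ?thesis using 3 by simp
    qed
  qed
  show ?thesis
  proof (rule borel_measurable_LIMSEQ_real)
    fix n
    show "(\<lambda>p :: real \<times> 'a. L (q n \<lfloor>real (Suc n) * fst p\<rfloor>) (snd p)) \<in> borel_measurable (borel \<Otimes>\<^sub>M N)"
    proof (rule measurable_compose_countable[where f="\<lambda>i p. L (q n i) (snd p)"])
      have [measurable]: "L (q n i) \<in> borel_measurable N" for i
        by (rule L) (use t in \<open>auto simp: q_def\<close>)
      show "(\<lambda>p. L (q n i) (snd p)) \<in> borel_measurable (borel \<Otimes>\<^sub>M N)" for i
        by measurable
    qed measurable
  next
    fix p :: "real \<times> 'a" assume "p \<in> space (borel \<Otimes>\<^sub>M N)"
    then show "(\<lambda>n. L (q n \<lfloor>real (Suc n) * fst p\<rfloor>) (snd p)) \<longlonglongrightarrow> (case p of (u, \<omega>) \<Rightarrow> L (max 0 (min u t)) \<omega>)"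
      using lim[of "snd p" "fst p"] by (auto simp: space_pair_measure split_beta')
  qed
qed

text \<open>This is the mirror image of the preceding argument, with grid points strictly to the
  left of \<sigma>. The \<sigma>-algebra is left general because the adaptedness of the stopped
  increments needs the result for \<open>F s\<close> and a truncated stopping time.\<close>

lemma left_limit_measurable:
  fixes L :: "real \<Rightarrow> 'a \<Rightarrow> real"
  assumes t: "0 \<le> t" "t < T"
    and L: "\<And>s. 0 \<le> s \<Longrightarrow> s \<le> t \<Longrightarrow> L s \<in> borel_measurable N"
    and cad: "\<And>\<omega>. \<omega> \<in> space N \<Longrightarrow> cadlag T (\<lambda>s. L s \<omega>)"
    and \<sigma>[measurable]: "\<sigma> \<in> borel_measurable N" and range: "\<And>\<omega>. \<omega> \<in> space N \<Longrightarrow> \<sigma> \<omega> \<in> {0..t}"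
  shows "(\<lambda>\<omega>. left_limit (\<lambda>s. L s \<omega>) (\<sigma> \<omega>)) \<in> borel_measurable N"
proof -
  define q where "q n i = max 0 (min t ((of_int i - 1) / real (Suc n)))" for n and i :: int
  have lim: "(\<lambda>n. L (q n \<lceil>real (Suc n) * s\<rceil>) \<omega>) \<longlonglongrightarrow> left_limit (\<lambda>s. L s \<omega>) s"
    if \<omega>: "\<omega> \<in> space N" and s: "0 \<le> s" "s \<le> t" for s \<omega>
  proof (cases "s = 0")
    case True
    \<comment> \<open>The grid point to the left of 0 is negative, and clamping sends it to 0, in
      accordance with the convention for \<open>left_limit\<close> at 0.\<close>
    then have "(of_int \<lceil>real (Suc n) * s\<rceil> - 1) / real (Suc n) \<le> 0" for n
      by (simp add: divide_le_0_iff)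
    then have "q n \<lceil>real (Suc n) * s\<rceil> = 0" for n
      unfolding q_def by (intro max_absorb1 min.coboundedI2)
    then show ?thesis using True by (simp add: left_limit_def)
  next
    case False
    then have s0: "0 < s" using s by simp
    let ?q = "\<lambda>n. q n \<lceil>real (Suc n) * s\<rceil>"
    \<comment> \<open>Reflection s -> -s carries the facts about the right grid over to the left
      grid.\<close>
    have ceil: "- ((of_int \<lfloor>real (Suc n) * (- s)\<rfloor> + 1) / real (Suc n))
          = (of_int \<lceil>real (Suc n) * s\<rceil> - 1) / real (Suc n)" for n
      unfolding ceiling_def by (simp add: minus_divide_left)
    have lt: "(of_int \<lceil>real (Suc n) * s\<rceil> - 1) / real (Suc n) < s" for n
      using less_grid_right[of "- s" n] unfolding ceil[symmetric] by linarith
    have "?q \<longlonglongrightarrow> max 0 (min t s)"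
    proof -
      have "(\<lambda>n. - ((of_int \<lfloor>real (Suc n) * (- s)\<rfloor> + 1) / real (Suc n))) \<longlonglongrightarrow> - (- s)"
        by (intro tendsto_minus tendsto_grid_right)
      then have "(\<lambda>n. (of_int \<lceil>real (Suc n) * s\<rceil> - 1) / real (Suc n)) \<longlonglongrightarrow> s"
        unfolding ceil by simp
      then show ?thesis
        unfolding q_def by (intro tendsto_max tendsto_min tendsto_const)
    qed
    moreover have "?q n < s" for n
      using s0 lt[of n] by (simp add: q_def)
    ultimately have "filterlim ?q (at_left s) sequentially"
      using s by (auto simp: filterlim_at less_imp_neq)
    then show ?thesis
      using tendsto_left_limit[OF cad[OF \<omega>] s0] s t by (auto intro: filterlim_compose)
  qed
  show ?thesis
  proof (rule borel_measurable_LIMSEQ_real)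
    fix n
    show "(\<lambda>\<omega>. L (q n \<lceil>real (Suc n) * \<sigma> \<omega>\<rceil>) \<omega>) \<in> borel_measurable N"
    proof (rule measurable_compose_countable[where f="\<lambda>i. L (q n i)"])
      show "L (q n i) \<in> borel_measurable N" for i
        by (rule L) (use t in \<open>auto simp: q_def\<close>)
    qed measurable
  next
    fix \<omega> assume "\<omega> \<in> space N"
    then show "(\<lambda>n. L (q n \<lceil>real (Suc n) * \<sigma> \<omega>\<rceil>) \<omega>) \<longlonglongrightarrow> left_limit (\<lambda>s. L s \<omega>) (\<sigma> \<omega>)"
      using lim range by auto
  qed
qed

lemma set_integrable_powr_weight:
  fixes T :: real
  assumes "0 < \<alpha>" "0 < T"
  shows "set_integrable lborel {0..T} (\<lambda>u. (T - u) powr (\<alpha> - 1))"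
  unfolding set_integrable_def
proof (rule integrableI_bounded)
  have "(\<integral>\<^sup>+x. ennreal (norm (indicator {0..T} (x::real) *\<^sub>R (T - x) powr (\<alpha> - 1))) \<partial>lborel)
     = (\<integral>\<^sup>+v\<in>{0..T}. ennreal ((T - v) powr (\<alpha> - 1)) \<partial>lborel)"
    by (intro nn_integral_cong) (auto simp: indicator_def)
  then show "(\<integral>\<^sup>+x. ennreal (norm (indicator {0..T} (x::real) *\<^sub>R (T - x) powr (\<alpha> - 1))) \<partial>lborel) < \<infinity>"
    using assms by (simp add: nn_integral_powr_tail)
qed auto

text \<open>The left limit passes under the integral by dominated convergence along sequences, with
  a constant multiple of the weight as majorant. For u < s the truncated path is eventually
  \<open>K u\<close> and cancels against the value at t. For u \<ge> s it tends to the left limit of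
  \<open>K\<close> at s.\<close>

lemma frac_int_minus_left_limit:
  assumes K: "cadlag T K" and \<alpha>: "0 < \<alpha>" and st: "0 \<le> s" "s \<le> t" "t < T"
    and C: "\<And>r. 0 \<le> r \<Longrightarrow> r \<le> t \<Longrightarrow> \<bar>K r\<bar> \<le> C"
  shows "frac_int T \<alpha> K t - left_limit (frac_int T \<alpha> K) s = \<alpha> / T powr \<alpha> *
    (LBINT u:{0..T}. (T - u) powr (\<alpha> - 1) * (if s \<le> u then K (min u t) - left_limit K s else 0))"
proof -
  define w where "w u = indicator {0..T} u * (T - u) powr (\<alpha> - 1)" for u :: real
  have [measurable]: "w \<in> borel_measurable borel" unfolding w_def by measurable
  have w: "integrable lborel w"
    using set_integrable_powr_weight[OF \<alpha>, of T] st by (simp add: set_integrable_def w_def[abs_def])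
  have w0: "0 \<le> w u" for u by (simp add: w_def)
  have w_out: "w u = 0" if "u < 0" for u using that by (simp add: w_def)
  have Kmeas[measurable]: "(\<lambda>u. K (max 0 (min u r))) \<in> borel_measurable borel" if "0 \<le> r" "r \<le> t" for r
  proof -
    \<comment> \<open>A single path is a process over a one-point space.\<close>
    have "(\<lambda>(u, \<omega>). (\<lambda>s _. K s) (max 0 (min u r)) \<omega>) \<in> borel_measurable (borel \<Otimes>\<^sub>M count_space {()})"
      by (rule cadlag_measurable_pair[where T=T]) (use that st K in auto)
    from measurable_compose[OF measurable_Pair2' this, of "()"] show ?thesis by simp
  qed
  have eq: "(LBINT u:{0..T}. (T - u) powr (\<alpha> - 1) * f u) = (\<integral>u. w u * f u \<partial>lborel)" for f
    by (simp add: set_lebesgue_integral_def w_def mult.assoc)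
  \<comment> \<open>The weight vanishes for negative u, so clamping at 0 leaves the integral
    unchanged and makes the integrand measurable on the whole line.\<close>
  have wK: "w u * K (min u r) = w u * K (max 0 (min u r))" if "0 \<le> r" for u r
    using that w_out[of u] by (cases "u < 0") (auto simp: max_def)
  have frac: "frac_int T \<alpha> K r = \<alpha> / T powr \<alpha> * (\<integral>u. w u * K (max 0 (min u r)) \<partial>lborel)"
    if "0 \<le> r" for r
    unfolding frac_int_def eq wK[OF that] ..
  have int_r: "integrable lborel (\<lambda>u. w u * K (max 0 (min u r)))" if r: "0 \<le> r" "r \<le> t" for r
  proof (rule Bochner_Integration.integrable_bound)
    show "integrable lborel (\<lambda>u. w u * C)" using w by simp
    have "\<bar>K (max 0 (min u r))\<bar> \<le> \<bar>C\<bar>" for u using C[of "max 0 (min u r)"] r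
      by (intro order_trans[OF C abs_ge_self]) auto
    then show "AE u in lborel. norm (w u * K (max 0 (min u r))) \<le> norm (w u * C)"
      using w0 by (auto simp: abs_mult intro!: mult_left_mono)
  qed (use r in measurable)
  \<comment> \<open>For s > 0 this is the pointwise limit of \<open>K (max 0 (min u r))\<close> as r
    increases to s. For u < s the cutoff at t has no effect because s \<le> t.\<close>
  let ?g = "\<lambda>u. if s \<le> u then left_limit K s else K (max 0 (min u t))"
  have [measurable]: "(\<lambda>u. K (max 0 (min u t))) \<in> borel_measurable borel" by (rule Kmeas) (use st in auto)
  have lim_le: "\<bar>left_limit K s\<bar> \<le> C"
    by (rule abs_left_limit_le[OF K]) (use st C in auto)
  have int_g: "integrable lborel (\<lambda>u. w u * ?g u)"
  proof (rule Bochner_Integration.integrable_bound)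
    show "integrable lborel (\<lambda>u. w u * C)" using w by simp
    have "\<bar>?g u\<bar> \<le> \<bar>C\<bar>" for u using C[of "max 0 (min u t)"] st lim_le by (auto intro: order_trans[OF _ abs_ge_self])
    then show "AE u in lborel. norm (w u * ?g u) \<le> norm (w u * C)"
      by (intro AE_I2) (simp only: real_norm_def abs_mult abs_of_nonneg[OF w0] mult_left_mono[OF _ w0])
  qed measurable
  have left: "left_limit (frac_int T \<alpha> K) s = \<alpha> / T powr \<alpha> * (\<integral>u. w u * ?g u \<partial>lborel)"
  proof (cases "s = 0")
    case True
    have "(\<lambda>u. w u * K (max 0 (min u 0))) = (\<lambda>u. w u * ?g u)"
      using True w_out by (auto simp: left_limit_def min_def max_def fun_eq_iff)
    moreover have "left_limit (frac_int T \<alpha> K) s = frac_int T \<alpha> K 0"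
      using True by (simp add: left_limit_def)
    ultimately show ?thesis by (simp only: frac order_refl)
  next
    case False
    then have s0: "0 < s" using st by simp
    have "(frac_int T \<alpha> K \<longlongrightarrow> \<alpha> / T powr \<alpha> * (\<integral>u. w u * ?g u \<partial>lborel)) (at_left s)"
    proof (rule tendsto_at_left_sequentially[OF s0])
      fix S :: "nat \<Rightarrow> real"
      assume S: "\<And>n. S n < s" "\<And>n. 0 < S n" "S \<longlonglongrightarrow> s"
      have "(\<lambda>n. \<integral>u. w u * K (max 0 (min u (S n))) \<partial>lborel) \<longlonglongrightarrow> (\<integral>u. w u * ?g u \<partial>lborel)"
      proof (rule integral_dominated_convergence)
        show "integrable lborel (\<lambda>u. w u * C)" using w by simp
        show "AE u in lborel. norm (w u * K (max 0 (min u (S n)))) \<le> w u * C" for n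
          using w0 S(1)[of n] S(2)[of n] st by (auto simp: abs_mult intro!: mult_left_mono C)
        show "AE u in lborel. (\<lambda>n. w u * K (max 0 (min u (S n)))) \<longlonglongrightarrow> w u * ?g u"
        proof (intro AE_I2 tendsto_mult tendsto_const)
          fix u
          show "(\<lambda>n. K (max 0 (min u (S n)))) \<longlonglongrightarrow> ?g u"
          proof (cases "s \<le> u")
            case True
            then have "max 0 (min u (S n)) = S n" for n using S(1)[of n] S(2)[of n] by auto
            moreover have "filterlim S (at_left s) sequentially"
              using S by (auto simp: filterlim_at less_imp_neq)
            ultimately show ?thesis
              using tendsto_left_limit[OF K s0] True st by (auto intro: filterlim_compose)
          next
            case False
            then have "eventually (\<lambda>n. u < S n) sequentially"
              using order_tendstoD(1)[OF S(3), of u] by simp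
            then have "eventually (\<lambda>n. K (max 0 (min u (S n))) = ?g u) sequentially"
              by eventually_elim (use False st in auto)
            then show ?thesis by (rule tendsto_eventually)
          qed
        qed
        show "(\<lambda>u. w u * K (max 0 (min u (S n)))) \<in> borel_measurable lborel" for n
        proof -
          have [measurable]: "(\<lambda>u. K (max 0 (min u (S n)))) \<in> borel_measurable borel"
            by (rule Kmeas) (use S(1)[of n] S(2)[of n] st in auto)
          show ?thesis by measurable
        qed
      qed measurable
      then show "(\<lambda>n. frac_int T \<alpha> K (S n)) \<longlonglongrightarrow> \<alpha> / T powr \<alpha> * (\<integral>u. w u * ?g u \<partial>lborel)"
        unfolding frac[OF less_imp_le[OF S(2)]] by (intro tendsto_mult tendsto_const)
    qed
    then have "Lim (at_left s) (frac_int T \<alpha> K) = \<alpha> / T powr \<alpha> * (\<integral>u. w u * ?g u \<partial>lborel)"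
      by (intro tendsto_Lim) auto
    then show ?thesis using False by (simp add: left_limit_def)
  qed
  have "frac_int T \<alpha> K t - left_limit (frac_int T \<alpha> K) s
      = \<alpha> / T powr \<alpha> * ((\<integral>u. w u * K (max 0 (min u t)) \<partial>lborel) - (\<integral>u. w u * ?g u \<partial>lborel))"
    unfolding left using st by (simp only: frac[of t] right_diff_distrib)
  also have "(\<integral>u. w u * K (max 0 (min u t)) \<partial>lborel) - (\<integral>u. w u * ?g u \<partial>lborel)
      = (\<integral>u. w u * K (max 0 (min u t)) - w u * ?g u \<partial>lborel)"
    using int_r[of t] int_g st by (intro Bochner_Integration.integral_diff[symmetric]) auto
  also have "\<dots> = (\<integral>u. w u * (if s \<le> u then K (min u t) - left_limit K s else 0) \<partial>lborel)"
    using st by (intro Bochner_Integration.integral_cong) (auto simp: right_diff_distrib)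
  finally show ?thesis by (simp only: eq)
qed

text \<open>By right continuity a violation at r < t persists on an interval to the right of r and
  so meets a rational below t. The endpoint t is included separately, since its right neighbourhood
  lies outside [0, t]. The point is to reduce an almost sure bound on the whole path to countably
  many times.\<close>

lemma cadlag_bounded_of_dense:
  assumes K: "cadlag T K" and t: "0 \<le> t" "t < T"
    and le: "\<forall>r\<in>insert t (\<rat> \<inter> {0..<t}). \<bar>K r\<bar> \<le> C"
    and r: "0 \<le> r" "r \<le> t"
  shows "\<bar>K r\<bar> \<le> C"
proof (rule ccontr)
  assume "\<not> \<bar>K r\<bar> \<le> C"
  then have gt: "C < \<bar>K r\<bar>" by simp
  then have "r < t" using le r by (cases "r = t") auto
  have "r \<in> {0..<T}" using r t by simp
  then have "((\<lambda>s. \<bar>K s\<bar>) \<longlongrightarrow> \<bar>K r\<bar>) (at_right r)"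
    using K unfolding cadlag_def by (intro tendsto_rabs) blast
  from order_tendstoD(1)[OF this gt] obtain b where b: "r < b" "\<And>y. r < y \<Longrightarrow> y < b \<Longrightarrow> C < \<bar>K y\<bar>"
    unfolding eventually_at_right[OF \<open>r < t\<close>] by blast
  then obtain q where "q \<in> \<rat>" "r < q" "q < min b t"
    using Rats_dense_in_real[of r "min b t"] \<open>r < t\<close> by auto
  then show False using b(2)[of q] bspec[OF le, of q] r by auto
qed

section \<open>Essential suprema and path bounds of martingales\<close>

context stochastic_basis
begin

lemma subalgebra_F: "s \<le> T \<Longrightarrow> subalgebra M (F s)"
  using sets_F_mono[of s T] sets_F_T space_F by (auto simp: subalgebra_def)

lemma subalgebra_pre_sigma:
  assumes "stopping_time F \<sigma>" "\<And>\<omega>. \<omega> \<in> space M \<Longrightarrow> \<sigma> \<omega> \<in> {0..T}"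
  shows "subalgebra M (pre_sigma \<sigma>)"
  using sets_pre_sigma_iff[OF assms] by (auto simp: subalgebra_def space_pre_sigma)

lemma finite_measure_subalgebraI: "subalgebra M G \<Longrightarrow> finite_measure_subalgebra M G"
  by unfold_locales

lemma martingale_integral_mult:
  assumes L: "martingale M F T L" and st: "0 \<le> s" "s \<le> t" "t < T"
    and Z: "Z \<in> borel_measurable (F s)" and int: "integrable M (\<lambda>\<omega>. Z \<omega> * L t \<omega>)"
  shows "(\<integral>\<omega>. Z \<omega> * L t \<omega> \<partial>M) = (\<integral>\<omega>. Z \<omega> * L s \<omega> \<partial>M)"
proof -
  have sub: "subalgebra M (F s)" using st by (intro subalgebra_F) simp
  interpret finite_measure_subalgebra M "F s"
    using sub by (rule finite_measure_subalgebraI)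
  have [measurable]: "L t \<in> borel_measurable M"
    using L st unfolding martingale_def by (auto intro: borel_measurable_integrable)
  have [measurable]: "Z \<in> borel_measurable M" using Z sub measurable_from_subalg by blast
  have "L s \<in> borel_measurable (F s)" using L st by (auto simp: martingale_def adapted_def)
  then have [measurable]: "L s \<in> borel_measurable M" using sub measurable_from_subalg by blast
  have AE: "AE \<omega> in M. real_cond_exp M (F s) (L t) \<omega> = L s \<omega>"
    using L st by (auto simp: martingale_def)
  have "(\<integral>\<omega>. Z \<omega> * L t \<omega> \<partial>M) = (\<integral>\<omega>. Z \<omega> * real_cond_exp M (F s) (L t) \<omega> \<partial>M)"
    by (rule real_cond_exp_intg(2)[symmetric, OF int Z]) measurable
  also have "\<dots> = (\<integral>\<omega>. Z \<omega> * L s \<omega> \<partial>M)"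
    by (rule integral_cong_AE) (use AE in auto)
  finally show ?thesis .
qed

text \<open>\<open>L s\<close> is a conditional expectation of \<open>L t\<close>, and conditioning
  preserves the bounds -c and c.\<close>

lemma Linf_norm_martingale_mono:
  assumes L: "martingale M F T L" and st: "0 \<le> s" "s \<le> t" "t < T"
  shows "Linf_norm M (L s) \<le> Linf_norm M (L t)"
proof (cases "Linf_norm M (L t) = \<infinity>")
  case False
  then obtain c where c: "Linf_norm M (L t) = ennreal c" "0 \<le> c"
    by (cases "Linf_norm M (L t)") auto
  have sub: "subalgebra M (F s)" using st by (intro subalgebra_F) simp
  interpret finite_measure_subalgebra M "F s"
    using sub by (rule finite_measure_subalgebraI)
  have int: "integrable M (L t)" "integrable M (L s)" using L st by (auto simp: martingale_def)
  have "AE \<omega> in M. ennreal \<bar>L t \<omega>\<bar> \<le> ennreal c"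
    using esssup_AE[of "\<lambda>\<omega>. ennreal \<bar>L t \<omega>\<bar>" M] c(1) by (simp add: Linf_norm_def)
  then have bd: "AE \<omega> in M. \<bar>L t \<omega>\<bar> \<le> c" using c(2) by simp
  have "AE \<omega> in M. real_cond_exp M (F s) (L t) \<omega> \<le> c"
    by (rule real_cond_exp_le_c[OF int(1)]) (use bd in \<open>auto simp: abs_le_iff\<close>)
  moreover have "AE \<omega> in M. real_cond_exp M (F s) (L t) \<omega> \<ge> - c"
    by (rule real_cond_exp_ge_c[OF int(1)]) (use bd in eventually_elim, auto)
  moreover have "AE \<omega> in M. real_cond_exp M (F s) (L t) \<omega> = L s \<omega>"
    using L st by (auto simp: martingale_def)
  ultimately have "AE \<omega> in M. ennreal \<bar>L s \<omega>\<bar> \<le> ennreal c"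
    by eventually_elim (auto intro!: ennreal_leI)
  then have "esssup M (\<lambda>\<omega>. ennreal \<bar>L s \<omega>\<bar>) \<le> ennreal c"
    using int by (intro esssup_I) auto
  then show ?thesis unfolding c(1) by (simp add: Linf_norm_def)
qed simp

text \<open>Monotonicity of the essential supremum bounds each \<open>L r\<close> outside a null set
  that depends on r. Countably many such null sets suffice by
  \<open>cadlag_bounded_of_dense\<close>.\<close>

lemma AE_path_bound:
  assumes L: "cadlag_martingale M F T L" and t: "0 \<le> t" "t < T" and fin: "Linf_norm M (L t) \<noteq> \<infinity>"
  shows "AE \<omega> in M. \<forall>r\<in>{0..t}. \<bar>L r \<omega>\<bar> \<le> enn2real (Linf_norm M (L t))"
proof -
  let ?C = "enn2real (Linf_norm M (L t))"
  have mart: "martingale M F T L" using L by (simp add: cadlag_martingale_def)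
  have "AE \<omega> in M. \<forall>r\<in>insert t (\<rat> \<inter> {0..<t}). \<bar>L r \<omega>\<bar> \<le> ?C"
  proof (rule AE_ball_countable')
    fix r assume "r \<in> insert t (\<rat> \<inter> {0..<t})"
    then have r: "0 \<le> r" "r \<le> t" using t by auto
    have "Linf_norm M (L r) \<le> ennreal ?C"
      using Linf_norm_martingale_mono[OF mart r t(2)] fin by (simp add: less_top)
    moreover have "AE \<omega> in M. ennreal \<bar>L r \<omega>\<bar> \<le> Linf_norm M (L r)"
      unfolding Linf_norm_def by (rule esssup_AE)
    ultimately have "AE \<omega> in M. ennreal \<bar>L r \<omega>\<bar> \<le> ennreal ?C"
      by (elim eventually_mono) (rule order_trans)
    then show "AE \<omega> in M. \<bar>L r \<omega>\<bar> \<le> ?C" by simp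
  qed (auto intro: countable_subset[OF _ countable_rat])
  with AE_space show ?thesis
  proof eventually_elim
    case (elim \<omega>)
    have "cadlag T (\<lambda>s. L s \<omega>)" using L elim by (simp add: cadlag_martingale_def)
    from cadlag_bounded_of_dense[OF this t elim(2)] show ?case by simp
  qed
qed

text \<open>
  The value of \<open>stopped_increment L t \<sigma> A u\<close> is known at time \<open>u\<close>, because \<open>A\<close> belongs to the \<open>\<sigma>\<close>-algebra of
  the stopping time.  The martingale property at deterministic times thus suffices to make the
  increments orthogonal, and no optional sampling theorem is needed.
\<close>

definition stopped_increment ::
  "(real \<Rightarrow> 'a \<Rightarrow> real) \<Rightarrow> real \<Rightarrow> ('a \<Rightarrow> real) \<Rightarrow> 'a set \<Rightarrow> real \<Rightarrow> 'a \<Rightarrow> real" where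
  "stopped_increment L t \<sigma> A u \<omega> = indicator A \<omega> *
    (if \<sigma> \<omega> \<le> u then L (max 0 (min u t)) \<omega> - left_limit (\<lambda>s. L s \<omega>) (\<sigma> \<omega>) else 0)"

section \<open>Orthogonality and second moments of the stopped increments\<close>

context
  fixes L :: "real \<Rightarrow> 'a \<Rightarrow> real" and t :: real and \<sigma> :: "'a \<Rightarrow> real" and A :: "'a set" and C :: real
  assumes L: "cadlag_martingale M F T L" and t: "0 \<le> t" "t < T"
    and \<sigma>: "stopping_time F \<sigma>" and range: "\<And>\<omega>. \<omega> \<in> space M \<Longrightarrow> \<sigma> \<omega> \<in> {0..t}"
    and A: "A \<in> sets (pre_sigma \<sigma>)" and C0: "0 \<le> C"
    and C: "\<And>\<omega> r. \<omega> \<in> A \<Longrightarrow> 0 \<le> r \<Longrightarrow> r \<le> t \<Longrightarrow> \<bar>L r \<omega>\<bar> \<le> C"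
begin

private abbreviation "Z \<equiv> stopped_increment L t \<sigma> A"

private lemma cadlag_path: "\<omega> \<in> space M \<Longrightarrow> cadlag T (\<lambda>s. L s \<omega>)"
  using L by (simp add: cadlag_martingale_def)

private lemma mart: "martingale M F T L"
  using L by (simp add: cadlag_martingale_def)

private lemma measurable_L: "0 \<le> s \<Longrightarrow> s \<le> r \<Longrightarrow> r < T \<Longrightarrow> L s \<in> borel_measurable (F r)"
  using mart sets_F_mono[of s r] space_F
  by (auto simp: martingale_def adapted_def intro!: measurable_from_subalg[of "F r" "F s"] simp: subalgebra_def)

private lemma measurable_L_M: "0 \<le> s \<Longrightarrow> s \<le> t \<Longrightarrow> L s \<in> borel_measurable M"
  using t by (intro measurable_from_subalg[OF subalgebra_F[of t]] measurable_L) auto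

private lemma range_T: "\<omega> \<in> space M \<Longrightarrow> \<sigma> \<omega> \<in> {0..T}"
  using range[of \<omega>] t by auto

private lemma A_M: "A \<in> sets M"
  using A sets_pre_sigma_iff[OF \<sigma> range_T] by blast

private lemma \<sigma>_M: "\<sigma> \<in> borel_measurable M"
  by (rule measurable_from_subalg[OF subalgebra_pre_sigma[OF \<sigma> range_T] measurable_stopping_time_pre_sigma[OF \<sigma>]])

text \<open>The paths are bounded everywhere on \<open>A\<close>, not just almost surely, so this
  bound is pointwise as Fubini is set up above. It is purely qualitative: \<open>C\<close> does not
  enter the final estimate.\<close>

lemma stopped_increment_bound: "\<bar>Z u \<omega>\<bar> \<le> 2 * C"
proof (cases "\<omega> \<in> A \<and> \<sigma> \<omega> \<le> u")
  case True
  then have \<omega>: "\<omega> \<in> space M" using A_M sets.sets_into_space by blast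
  have "\<bar>L (max 0 (min u t)) \<omega>\<bar> \<le> C" using C True t by auto
  moreover have "\<bar>left_limit (\<lambda>s. L s \<omega>) (\<sigma> \<omega>)\<bar> \<le> C"
    by (rule abs_left_limit_le[OF cadlag_path[OF \<omega>]]) (use range[OF \<omega>] C True t in auto)
  ultimately show ?thesis using True by (simp add: stopped_increment_def)
qed (auto simp: stopped_increment_def C0)

lemma stopped_increment_measurable_pair: "case_prod Z \<in> borel_measurable (borel \<Otimes>\<^sub>M M)"
proof -
  have [measurable]: "(\<lambda>p. L (max 0 (min (fst p) t)) (snd p)) \<in> borel_measurable (borel \<Otimes>\<^sub>M M)"
    using cadlag_measurable_pair[OF t measurable_L_M cadlag_path] by (simp add: split_beta')
  have [measurable]: "(\<lambda>\<omega>. left_limit (\<lambda>s. L s \<omega>) (\<sigma> \<omega>)) \<in> borel_measurable M"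
    by (rule left_limit_measurable[OF t measurable_L_M cadlag_path \<sigma>_M range])
  note [measurable] = A_M \<sigma>_M
  show ?thesis unfolding stopped_increment_def split_beta' by measurable
qed

text \<open>The stopping time itself need not be measurable with respect to \<open>F s\<close>, but
  its minimum with s is. The two agree on the part of \<open>A\<close> where \<sigma> \<le> s, and
  outside it the increment vanishes.\<close>

lemma stopped_increment_adapted:
  assumes s: "0 \<le> s" "s \<le> t"
  shows "Z s \<in> borel_measurable (F s)"
proof -
  have [measurable]: "{\<omega>\<in>A. \<sigma> \<omega> \<le> s} \<in> sets (F s)" by (rule sets_pre_sigmaD[OF \<sigma> A])
  have [measurable]: "L s \<in> borel_measurable (F s)" using s t by (intro measurable_L) auto
  have min_meas: "(\<lambda>\<omega>. min (\<sigma> \<omega>) s) \<in> borel_measurable (F s)"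
  proof (rule borel_measurableI_le)
    fix x
    have "{\<omega> \<in> space (F s). \<sigma> \<omega> \<le> x} \<in> sets (F s)" if "x < s"
      using stopping_time_le_const[OF \<sigma>, of x s] that by (simp add: pred_def)
    then show "{\<omega> \<in> space (F s). min (\<sigma> \<omega>) s \<le> x} \<in> sets (F s)"
      by (cases "x < s") (auto simp: min_le_iff_disj not_less)
  qed
  have [measurable]: "(\<lambda>\<omega>. left_limit (\<lambda>s. L s \<omega>) (min (\<sigma> \<omega>) s)) \<in> borel_measurable (F s)"
    by (rule left_limit_measurable[where t=s and T=T])
      (use s t range cadlag_path min_meas measurable_L in \<open>auto simp: space_F min_def\<close>)
  have "Z s = (\<lambda>\<omega>. indicator {\<omega>\<in>A. \<sigma> \<omega> \<le> s} \<omega> * (L s \<omega> - left_limit (\<lambda>s. L s \<omega>) (min (\<sigma> \<omega>) s)))"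
    using s by (auto simp: stopped_increment_def fun_eq_iff indicator_def min_def)
  also have "\<dots> \<in> borel_measurable (F s)" by measurable
  finally show ?thesis .
qed

text \<open>Once \<sigma> \<le> u, the increments at u and v share the same left limit and differ by
  \<open>L r - L s\<close>, where s and r are u and v cut off at t. The product is thus
  \<open>(Z s \<omega>)\<^sup>2\<close> plus \<open>Z s\<close> times this difference. The last term
  has mean zero, because \<open>Z s\<close> is measurable with respect to
  \<open>F s\<close>.\<close>

lemma stopped_increment_orthogonal:
  assumes uv: "u \<le> v"
  shows "(\<integral>\<omega>. Z u \<omega> * Z v \<omega> \<partial>M) = (\<integral>\<omega>. (Z u \<omega>)\<^sup>2 \<partial>M)"
proof (cases "u < 0")
  case True
  have "Z u \<omega> = 0" if "\<omega> \<in> space M" for \<omega>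
    using range[OF that] True by (auto simp: stopped_increment_def)
  then show ?thesis by (auto intro!: Bochner_Integration.integral_cong)
next
  case False
  define s r where "s = min u t" and "r = min v t"
  have sr: "0 \<le> s" "s \<le> r" "r \<le> t" "s \<le> t" "r < T" using False uv t by (auto simp: s_def r_def)
  \<comment> \<open>Since \<sigma> \<le> t, the conditions \<sigma> \<le> u and \<sigma> \<le> min u
    t are equivalent.\<close>
  have Zs: "Z u \<omega> = Z s \<omega>" if "\<omega> \<in> space M" for \<omega>
    using range[OF that] False t by (auto simp: stopped_increment_def s_def)
  have [measurable]: "Z s \<in> borel_measurable M"
    using t sr by (intro measurable_from_subalg[OF subalgebra_F[of s]] stopped_increment_adapted) auto
  have int: "integrable M (\<lambda>\<omega>. Z s \<omega> * L x \<omega>)" if x: "0 \<le> x" "x < T" for x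
  proof (rule Bochner_Integration.integrable_bound)
    have Lx: "integrable M (L x)" using mart x by (auto simp: martingale_def)
    then show "integrable M (\<lambda>\<omega>. (2 * C) * L x \<omega>)" by simp
    show "(\<lambda>\<omega>. Z s \<omega> * L x \<omega>) \<in> borel_measurable M" using Lx by measurable
    show "AE \<omega> in M. norm (Z s \<omega> * L x \<omega>) \<le> norm (2 * C * L x \<omega>)"
      using stopped_increment_bound[of s] C0 by (intro AE_I2) (auto simp: abs_mult intro!: mult_right_mono)
  qed
  have eq: "Z u \<omega> * Z v \<omega> = (Z s \<omega>)\<^sup>2 + (Z s \<omega> * L r \<omega> - Z s \<omega> * L s \<omega>)" if "\<omega> \<in> space M" for \<omega>
    unfolding Zs[OF that] using range[OF that] sr uv False t
    by (auto simp: stopped_increment_def s_def r_def power2_eq_square algebra_simps indicator_def max_def)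
  have sq: "integrable M (\<lambda>\<omega>. (Z s \<omega>)\<^sup>2)"
  proof (rule integrable_const_bound[where B="(2 * C)\<^sup>2"])
    show "AE \<omega> in M. norm ((Z s \<omega>)\<^sup>2) \<le> (2 * C)\<^sup>2"
      using power_mono[OF stopped_increment_bound[of s] abs_ge_zero, of _ 2] by (intro AE_I2) simp
  qed measurable
  have "(\<integral>\<omega>. Z u \<omega> * Z v \<omega> \<partial>M) = (\<integral>\<omega>. (Z s \<omega>)\<^sup>2 + (Z s \<omega> * L r \<omega> - Z s \<omega> * L s \<omega>) \<partial>M)"
    by (intro Bochner_Integration.integral_cong refl) (simp only: eq)
  also have "\<dots> = (\<integral>\<omega>. (Z s \<omega>)\<^sup>2 \<partial>M) + ((\<integral>\<omega>. Z s \<omega> * L r \<omega> \<partial>M) - (\<integral>\<omega>. Z s \<omega> * L s \<omega> \<partial>M))"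
    using int sq sr by simp
  also have "(\<integral>\<omega>. Z s \<omega> * L r \<omega> \<partial>M) = (\<integral>\<omega>. Z s \<omega> * L s \<omega> \<partial>M)"
    using sr int by (intro martingale_integral_mult[OF mart] stopped_increment_adapted) auto
  also have "(\<integral>\<omega>. (Z s \<omega>)\<^sup>2 \<partial>M) = (\<integral>\<omega>. (Z u \<omega>)\<^sup>2 \<partial>M)"
    by (intro Bochner_Integration.integral_cong refl) (simp add: Zs)
  finally show ?thesis by simp
qed

text \<open>Where the increment is nonzero, \<sigma> \<le> min u t, so both of its terms involve the
  path only up to time u. Each is almost surely at most the essential supremum of
  \<open>L u\<close>, and squaring the sum gives the factor 4. A bound at time u rather than t is
  what leaves the norm inside the time integral.\<close>

lemma stopped_increment_second_moment:
  assumes u: "0 \<le> u" "u < T" and fin: "Linf_norm M (L u) \<noteq> \<infinity>"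
  shows "(\<integral>\<omega>. (Z u \<omega>)\<^sup>2 \<partial>M) \<le> 4 * (enn2real (Linf_norm M (L u)))\<^sup>2 * measure M A"
proof -
  define s where "s = min u t"
  let ?c = "enn2real (Linf_norm M (L u))"
  have s: "0 \<le> s" "s \<le> t" "s < T" "s \<le> u" using u t by (auto simp: s_def)
  have le: "Linf_norm M (L s) \<le> Linf_norm M (L u)"
    using s u by (intro Linf_norm_martingale_mono[OF mart]) auto
  then have "enn2real (Linf_norm M (L s)) \<le> ?c"
    using fin by (intro enn2real_mono) (auto simp: less_top)
  moreover have "Linf_norm M (L s) \<noteq> \<infinity>" using le fin by (auto simp: top_unique)
  ultimately have "AE \<omega> in M. \<forall>r\<in>{0..s}. \<bar>L r \<omega>\<bar> \<le> ?c"
    using AE_path_bound[OF L s(1,3)] by (auto elim!: eventually_mono dest: order_trans)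
  with AE_space have "AE \<omega> in M. (Z u \<omega>)\<^sup>2 \<le> 4 * ?c\<^sup>2 * indicator A \<omega>"
  proof eventually_elim
    case (elim \<omega>)
    show ?case
    proof (cases "\<omega> \<in> A \<and> \<sigma> \<omega> \<le> u")
      case True
      then have "\<sigma> \<omega> \<in> {0..s}" using range[OF elim(1)] by (auto simp: s_def)
      moreover have "\<bar>left_limit (\<lambda>s. L s \<omega>) (\<sigma> \<omega>)\<bar> \<le> ?c"
        by (rule abs_left_limit_le[OF cadlag_path[OF elim(1)]]) (use calculation elim(2) s in auto)
      moreover have "\<bar>L (max 0 (min u t)) \<omega>\<bar> \<le> ?c" using elim(2) s by (auto simp: s_def max_def)
      ultimately have "\<bar>Z u \<omega>\<bar> \<le> 2 * ?c" using True by (simp add: stopped_increment_def)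
      from power_mono[OF this abs_ge_zero, of 2] show ?thesis using True by (simp add: power_mult_distrib)
    qed (auto simp: stopped_increment_def)
  qed
  moreover have "Z u \<in> borel_measurable M"
    using measurable_compose[OF measurable_Pair1' stopped_increment_measurable_pair, of u] by simp
  then have "integrable M (\<lambda>\<omega>. (Z u \<omega>)\<^sup>2)"
    using power_mono[OF stopped_increment_bound[of u] abs_ge_zero, of _ 2]
    by (intro integrable_const_bound[where B="(2 * C)\<^sup>2"] AE_I2) simp_all
  ultimately have "(\<integral>\<omega>. (Z u \<omega>)\<^sup>2 \<partial>M) \<le> (\<integral>\<omega>. 4 * ?c\<^sup>2 * indicator A \<omega> \<partial>M)"
    using A_M by (intro integral_mono_AE) (auto simp: less_top[symmetric])
  then show ?thesis using A_M sets.sets_into_space[OF A_M] by (simp add: Int_absorb2)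
qed

text \<open>The path bound needed for \<open>frac_int_minus_left_limit\<close> is available on
  \<open>A\<close> only; off \<open>A\<close> both sides vanish.\<close>

lemma jump_eq_integral_stopped_increment:
  assumes \<alpha>: "0 < \<alpha>" and \<omega>: "\<omega> \<in> space M"
  shows "indicator A \<omega> * (frac_int_process T \<alpha> L t \<omega> - left_limit (\<lambda>s. frac_int_process T \<alpha> L s \<omega>) (\<sigma> \<omega>))
    = \<alpha> / T powr \<alpha> * (\<integral>u. Z u \<omega> \<partial>powr_measure T \<alpha>)"
proof -
  let ?K = "\<lambda>u. L u \<omega>"
  have [measurable]: "(\<lambda>u. Z u \<omega>) \<in> borel_measurable lborel"
    using measurable_compose[OF measurable_Pair2'[OF \<omega>] stopped_increment_measurable_pair] by simp
  have "(\<integral>u. Z u \<omega> \<partial>powr_measure T \<alpha>) = (\<integral>u. (indicator {0..T} u * (T - u) powr (\<alpha> - 1)) * Z u \<omega> \<partial>lborel)"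
    unfolding powr_measure_def by (subst integral_density) auto
  also have "\<dots> = indicator A \<omega> * (LBINT u:{0..T}. (T - u) powr (\<alpha> - 1) *
      (if \<sigma> \<omega> \<le> u then ?K (min u t) - left_limit ?K (\<sigma> \<omega>) else 0))"
    unfolding set_lebesgue_integral_def integral_mult_right_zero[symmetric] using t
    by (intro Bochner_Integration.integral_cong refl)
      (auto simp: stopped_increment_def indicator_def max_def)
  finally have int: "(\<integral>u. Z u \<omega> \<partial>powr_measure T \<alpha>) = \<dots>" .
  show ?thesis
  proof (cases "\<omega> \<in> A")
    case True
    have "frac_int T \<alpha> ?K t - left_limit (frac_int T \<alpha> ?K) (\<sigma> \<omega>) = \<alpha> / T powr \<alpha> *
        (LBINT u:{0..T}. (T - u) powr (\<alpha> - 1) * (if \<sigma> \<omega> \<le> u then ?K (min u t) - left_limit ?K (\<sigma> \<omega>) else 0))"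
      by (rule frac_int_minus_left_limit[OF cadlag_path[OF \<omega>] \<alpha>]) (use range[OF \<omega>] t C[OF True] in auto)
    then show ?thesis using True by (simp add: int frac_int_process_def[abs_def])
  qed (simp add: int)
qed

text \<open>The constant is the product of the squared prefactor of the fractional integral, 2 from
  the two time orders, 4 from \<open>stopped_increment_second_moment\<close> and 1 / \<alpha> from
  the tail mass. The exponent 2\<alpha> - 1 adds \<alpha> - 1 from the weight and \<alpha> from the
  tail.\<close>

lemma set_integral_jump_square_le:
  assumes \<alpha>: "0 < \<alpha>" and fin: "\<And>u. 0 \<le> u \<Longrightarrow> u < T \<Longrightarrow> Linf_norm M (L u) \<noteq> \<infinity>"
  shows "(\<integral>\<^sup>+\<omega>. indicator A \<omega> * ennreal (\<bar>frac_int_process T \<alpha> L t \<omega>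
        - left_limit (\<lambda>s. frac_int_process T \<alpha> L s \<omega>) (\<sigma> \<omega>)\<bar>\<^sup>2) \<partial>M)
    \<le> ennreal (8 * \<alpha> / (T powr \<alpha>)\<^sup>2) *
      (\<integral>\<^sup>+u\<in>{0..<T}. ennreal ((T - u) powr (2 * \<alpha> - 1)) * (Linf_norm M (L u))\<^sup>2 \<partial>lborel) * emeasure M A"
\<comment> \<open>The other case divides by \<open>c\<close>, which is proportional to
  \<open>measure M A\<close>.\<close>
proof (cases "measure M A = 0")
  case True
  then have "A \<in> null_sets M" using A_M by (simp add: null_sets_def emeasure_eq_measure)
  then have "AE \<omega> in M. \<omega> \<notin> A" by (rule AE_not_in)
  then have "(\<integral>\<^sup>+\<omega>. indicator A \<omega> * ennreal (\<bar>frac_int_process T \<alpha> L t \<omega>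
        - left_limit (\<lambda>s. frac_int_process T \<alpha> L s \<omega>) (\<sigma> \<omega>)\<bar>\<^sup>2) \<partial>M) = (\<integral>\<^sup>+\<omega>. 0 \<partial>M)"
    by (intro nn_integral_cong_AE) (auto elim!: eventually_mono)
  then show ?thesis by simp
next
  case False
  then have P0: "0 < measure M A" by (simp add: zero_less_measure_iff)
  define N where "N = powr_measure T \<alpha>"
  define a where "a = \<alpha> / T powr \<alpha>"
  define c where "c = 4 * measure M A / \<alpha>"
  have c0: "0 < c" using P0 \<alpha> by (simp add: c_def)
  define \<Phi> where "\<Phi> u = (\<integral>\<omega>. (Z u \<omega>)\<^sup>2 \<partial>M)" for u
  have N: "finite_measure N" and [measurable_cong]: "sets N = sets borel"
    using finite_powr_measure[OF \<alpha>] T_pos by (auto simp: N_def powr_measure_def)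
  have tail: "measure N {u..} = (T - u) powr \<alpha> / \<alpha>" if "0 \<le> u" "u \<le> T" for u
    unfolding N_def using that by (rule measure_powr_measure[OF \<alpha>])
  have Z: "case_prod Z \<in> borel_measurable (N \<Otimes>\<^sub>M M)"
    using stopped_increment_measurable_pair by (simp cong: measurable_cong_sets)
  note second = second_moment_orthogonal_le[OF N \<open>sets N = sets borel\<close> finite_measure_axioms Z stopped_increment_bound stopped_increment_orthogonal]
  have \<Phi>N: "integrable N (\<lambda>u. \<Phi> u * measure N {u..})"
    unfolding \<Phi>_def by (rule second(2))
  have sq: "integrable M (\<lambda>\<omega>. (\<integral>u. Z u \<omega> \<partial>N)\<^sup>2)"
    by (rule second_moment_integral(2)[OF N finite_measure_axioms Z stopped_increment_bound])
  have \<Phi>0: "0 \<le> \<Phi> u" for u by (simp add: \<Phi>_def)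
  define J where "J = (\<integral>\<^sup>+u\<in>{0..<T}. ennreal ((T - u) powr (2 * \<alpha> - 1)) * (Linf_norm M (L u))\<^sup>2 \<partial>lborel)"
  \<comment> \<open>The constant is divided out on the side of \<open>\<Phi>\<close>, which is
    measurable. Pulling it out of \<open>J\<close> would require measurability of the essential
    supremum in u, which is not established; monotonicity of the integral does without it.\<close>
  have pt: "ennreal (indicator {0..T} u * (T - u) powr (\<alpha> - 1)) * ennreal (\<Phi> u * measure N {u..} / c)
      \<le> ennreal ((T - u) powr (2 * \<alpha> - 1)) * (Linf_norm M (L u))\<^sup>2 * indicator {0..<T} u" for u
  proof (cases "0 \<le> u \<and> u < T")
    case True
    then obtain m where m: "Linf_norm M (L u) = ennreal m" "0 \<le> m"
      using fin[of u] by (cases "Linf_norm M (L u)") auto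
    have "\<Phi> u \<le> 4 * m\<^sup>2 * measure M A"
      using stopped_increment_second_moment[of u] True fin m by (simp add: \<Phi>_def)
    then have "\<Phi> u / c \<le> \<alpha> * m\<^sup>2"
      using P0 \<alpha> by (simp add: c_def field_simps)
    then have "\<Phi> u / c / \<alpha> \<le> m\<^sup>2"
      by (subst pos_divide_le_eq[OF \<alpha>]) (simp only: mult.commute)
    then have "(T - u) powr (2 * \<alpha> - 1) * (\<Phi> u / c / \<alpha>) \<le> (T - u) powr (2 * \<alpha> - 1) * m\<^sup>2"
      by (intro mult_left_mono) simp_all
    moreover have "(T - u) powr (2 * \<alpha> - 1) = (T - u) powr (\<alpha> - 1) * (T - u) powr \<alpha>"
      by (simp add: powr_add[symmetric])
    moreover have "measure N {u..} = (T - u) powr \<alpha> / \<alpha>" using True by (intro tail) auto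
    ultimately have "(T - u) powr (\<alpha> - 1) * (\<Phi> u * measure N {u..} / c) \<le> (T - u) powr (2 * \<alpha> - 1) * m\<^sup>2"
      by (simp add: mult_ac)
    then show ?thesis
      using True m \<Phi>0[of u] c0 by (simp add: ennreal_mult'[symmetric] ennreal_power)
  next
    case False
    \<comment> \<open>At u = T this relies on \<open>0 powr x = 0\<close>, which reconciles the
      closed interval of the weight with the half-open one in \<open>J\<close>.\<close>
    then have "indicator {0..T} u * (T - u) powr (\<alpha> - 1) = 0" by (auto simp: indicator_def)
    then show ?thesis by (simp only: ennreal_0 mult_zero_left zero_le)
  qed
  have "ennreal (\<integral>u. \<Phi> u * measure N {u..} \<partial>N) = ennreal c * ennreal (\<integral>u. \<Phi> u * measure N {u..} / c \<partial>N)"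
    using c0 \<Phi>0 by (subst ennreal_mult[symmetric]) (auto intro!: integral_nonneg_AE divide_nonneg_pos mult_nonneg_nonneg)
  also have "ennreal (\<integral>u. \<Phi> u * measure N {u..} / c \<partial>N) = (\<integral>\<^sup>+u. ennreal (\<Phi> u * measure N {u..} / c) \<partial>N)"
    using \<Phi>N \<Phi>0 c0 by (intro nn_integral_eq_integral[symmetric]) auto
  also have "\<dots> = (\<integral>\<^sup>+u. ennreal (indicator {0..T} u * (T - u) powr (\<alpha> - 1)) * ennreal (\<Phi> u * measure N {u..} / c) \<partial>lborel)"
  proof -
    have "(\<lambda>u. ennreal (\<Phi> u * measure N {u..} / c)) \<in> borel_measurable lborel"
      using borel_measurable_integrable[OF \<Phi>N] by (simp cong: measurable_cong_sets)
    then show ?thesis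
      unfolding N_def powr_measure_def by (subst nn_integral_density) auto
  qed
  also have "\<dots> \<le> J"
    unfolding J_def by (intro nn_integral_mono pt)
  finally have \<Phi>J: "ennreal (\<integral>u. \<Phi> u * measure N {u..} \<partial>N) \<le> ennreal c * J"
    by (simp add: mult_left_mono)
  have "(\<integral>\<^sup>+\<omega>. indicator A \<omega> * ennreal (\<bar>frac_int_process T \<alpha> L t \<omega>
        - left_limit (\<lambda>s. frac_int_process T \<alpha> L s \<omega>) (\<sigma> \<omega>)\<bar>\<^sup>2) \<partial>M)
      = (\<integral>\<^sup>+\<omega>. ennreal (a\<^sup>2 * (\<integral>u. Z u \<omega> \<partial>N)\<^sup>2) \<partial>M)"
  proof (intro nn_integral_cong)
    fix \<omega> assume "\<omega> \<in> space M"
    from jump_eq_integral_stopped_increment[OF \<alpha> this] show "indicator A \<omega> * ennreal (\<bar>frac_int_process T \<alpha> L t \<omega>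
        - left_limit (\<lambda>s. frac_int_process T \<alpha> L s \<omega>) (\<sigma> \<omega>)\<bar>\<^sup>2) = ennreal (a\<^sup>2 * (\<integral>u. Z u \<omega> \<partial>N)\<^sup>2)"
      unfolding N_def a_def power_mult_distrib[symmetric] by (auto simp: indicator_def split: if_splits)
  qed
  also have "\<dots> = ennreal (a\<^sup>2 * (\<integral>\<omega>. (\<integral>u. Z u \<omega> \<partial>N)\<^sup>2 \<partial>M))"
    using sq by (subst nn_integral_eq_integral) auto
  also have "\<dots> \<le> ennreal (a\<^sup>2 * (2 * (\<integral>u. \<Phi> u * measure N {u..} \<partial>N)))"
    unfolding \<Phi>_def by (intro ennreal_leI mult_left_mono second(1)) auto
  also have "\<dots> = ennreal (2 * a\<^sup>2) * ennreal (\<integral>u. \<Phi> u * measure N {u..} \<partial>N)"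
    by (subst ennreal_mult'[symmetric]) (auto simp: mult_ac)
  also have "\<dots> \<le> ennreal (2 * a\<^sup>2) * (ennreal c * J)"
    by (intro mult_left_mono \<Phi>J) auto
  also have "\<dots> = ennreal (2 * a\<^sup>2 * c) * J"
    using c0 by (simp add: ennreal_mult mult.assoc)
  also have "2 * a\<^sup>2 * c = 8 * \<alpha> / (T powr \<alpha>)\<^sup>2 * measure M A"
    using \<alpha> by (simp add: a_def c_def power2_eq_square)
  also have "ennreal \<dots> * J = ennreal (8 * \<alpha> / (T powr \<alpha>)\<^sup>2) * J * emeasure M A"
    by (subst ennreal_mult'') (simp_all add: emeasure_eq_measure mult_ac)
  finally show ?thesis by (simp only: J_def)
qed

end

text \<open>
  A null set carrying the unbounded paths may be removed from \<open>A\<close>: it belongs to \<open>F 0\<close>, hence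
  to the \<open>\<sigma>\<close>-algebra of every stopping time.
\<close>

lemma cond_exp_jump_square_le:
  assumes L: "cadlag_martingale M F T L" and t: "0 \<le> t" "t < T"
    and \<sigma>: "stopping_time F \<sigma>" and range: "\<And>\<omega>. \<omega> \<in> space M \<Longrightarrow> \<sigma> \<omega> \<in> {0..t}"
    and \<alpha>: "0 < \<alpha>" and fin: "\<And>u. 0 \<le> u \<Longrightarrow> u < T \<Longrightarrow> Linf_norm M (L u) \<noteq> \<infinity>"
    and c: "ennreal (8 * \<alpha> / (T powr \<alpha>)\<^sup>2) *
      (\<integral>\<^sup>+u\<in>{0..<T}. ennreal ((T - u) powr (2 * \<alpha> - 1)) * (Linf_norm M (L u))\<^sup>2 \<partial>lborel) \<le> c" "c < \<infinity>"
  shows "AE \<omega> in M. nn_cond_exp M (pre_sigma \<sigma>) (\<lambda>\<omega>. ennreal (\<bar>frac_int_process T \<alpha> L t \<omega>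
    - left_limit (\<lambda>s. frac_int_process T \<alpha> L s \<omega>) (\<sigma> \<omega>)\<bar>\<^sup>2)) \<omega> \<le> c"
    (is "AE \<omega> in M. nn_cond_exp M _ ?f \<omega> \<le> c")
proof -
  have range_T: "\<sigma> \<omega> \<in> {0..T}" if "\<omega> \<in> space M" for \<omega>
    using range[OF that] t by auto
  have sub: "subalgebra M (pre_sigma \<sigma>)" by (rule subalgebra_pre_sigma[OF \<sigma> range_T])
  let ?C = "enn2real (Linf_norm M (L t))"
  have "AE \<omega> in M. \<forall>r\<in>{0..t}. \<bar>L r \<omega>\<bar> \<le> ?C"
    using AE_path_bound[OF L t] fin t by simp
  then obtain B where B: "B \<in> null_sets M" "\<And>\<omega>. \<omega> \<in> space M - B \<Longrightarrow> \<forall>r\<in>{0..t}. \<bar>L r \<omega>\<bar> \<le> ?C"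
    by (auto elim!: AE_E3)
  have le: "(\<integral>\<^sup>+\<omega>. indicator A \<omega> * ?f \<omega> \<partial>M) \<le> c * emeasure M A"
    if A: "A \<in> sets (pre_sigma \<sigma>)" for A
  proof -
    have A_M: "A \<in> sets M" using A sub by (auto simp: subalgebra_def)
    have "B \<in> sets (F 0)" using B(1) by (simp add: sets_F_0)
    have AB: "A - B \<in> sets (pre_sigma \<sigma>)"
    proof (rule iffD2[OF sets_pre_sigma_iff[OF \<sigma> range_T]], assumption, intro conjI ballI)
      show "A - B \<in> sets M" using A_M B(1) by auto
      fix s assume "s \<in> {0..T}"
      then have "B \<in> sets (F s)" using \<open>B \<in> sets (F 0)\<close> sets_F_mono[of 0 s] by auto
      then have "{\<omega>\<in>A. \<sigma> \<omega> \<le> s} - B \<in> sets (F s)" using sets_pre_sigmaD[OF \<sigma> A] by auto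
      also have "{\<omega>\<in>A. \<sigma> \<omega> \<le> s} - B = {\<omega>\<in>A - B. \<sigma> \<omega> \<le> s}" by auto
      finally show "{\<omega>\<in>A - B. \<sigma> \<omega> \<le> s} \<in> sets (F s)" .
    qed
    have "AE \<omega> in M. \<omega> \<notin> B" using B(1) by (rule AE_not_in)
    then have "(\<integral>\<^sup>+\<omega>. indicator A \<omega> * ?f \<omega> \<partial>M) = (\<integral>\<^sup>+\<omega>. indicator (A - B) \<omega> * ?f \<omega> \<partial>M)"
      by (intro nn_integral_cong_AE) (auto elim!: eventually_mono simp: indicator_def)
    also have "\<dots> \<le> ennreal (8 * \<alpha> / (T powr \<alpha>)\<^sup>2) *
        (\<integral>\<^sup>+u\<in>{0..<T}. ennreal ((T - u) powr (2 * \<alpha> - 1)) * (Linf_norm M (L u))\<^sup>2 \<partial>lborel) * emeasure M (A - B)"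
      using sets.sets_into_space[OF A_M] B(2)
      by (intro set_integral_jump_square_le[OF L t \<sigma> range AB _ _ \<alpha> fin, where C="?C"]) auto
    also have "\<dots> \<le> c * emeasure M A"
      using A_M by (intro mult_mono c(1) emeasure_mono) auto
    finally show ?thesis .
  qed
  interpret finite_measure_subalgebra M "pre_sigma \<sigma>"
    using sub by (rule finite_measure_subalgebraI)
  show ?thesis
  proof (cases "?f \<in> borel_measurable M")
    case True
    then show ?thesis using c(2) le by (rule nn_cond_exp_le_const)
  qed (simp add: nn_cond_exp_def) \<comment> \<open>junk value 0 on non-measurable functions\<close>
qed

section \<open>From the conditional estimate to the BMO norm\<close>

text \<open>An infinite norm at s would persist on all of [s, T) by monotonicity. This interval has
  positive length and positive weight, so the integral would be infinite.\<close>

lemma Linf_norm_finite: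
  assumes L: "martingale M F T L"
    and fin: "(\<integral>\<^sup>+u\<in>{0..<T}. ennreal ((T - u) powr \<beta>) * (Linf_norm M (L u))\<^sup>2 \<partial>lborel) \<noteq> \<infinity>"
    and s: "0 \<le> s" "s < T"
  shows "Linf_norm M (L s) \<noteq> \<infinity>"
proof
  assume inf: "Linf_norm M (L s) = \<infinity>"
  have "\<infinity> = \<infinity> * emeasure lborel {s..<T}"
    using s by (simp add: ennreal_top_mult)
  also have "\<dots> = (\<integral>\<^sup>+u. \<infinity> * indicator {s..<T} u \<partial>lborel)"
    by (rule nn_integral_cmult_indicator[symmetric]) simp
  also have "\<dots> \<le> (\<integral>\<^sup>+u\<in>{0..<T}. ennreal ((T - u) powr \<beta>) * (Linf_norm M (L u))\<^sup>2 \<partial>lborel)"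
  proof (rule nn_integral_mono)
    fix u
    show "\<infinity> * indicator {s..<T} u \<le> ennreal ((T - u) powr \<beta>) * (Linf_norm M (L u))\<^sup>2 * indicator {0..<T} u"
    proof (cases "u \<in> {s..<T}")
      case True
      then have "Linf_norm M (L u) = \<infinity>"
        using Linf_norm_martingale_mono[OF L s(1), of u] inf by (auto simp: top_unique)
      then show ?thesis using True s by (simp add: power2_eq_square ennreal_mult_top)
    qed simp
  qed
  finally show False using fin by (simp add: top_unique)
qed

end

theorem theorem3:
  fixes M :: "'a measure" and F :: "real \<Rightarrow> 'a measure" and T \<theta> \<alpha> :: real
    and L :: "real \<Rightarrow> 'a \<Rightarrow> real"
  assumes "stochastic_basis M F T"
    and "0 < \<theta>" and "\<theta> < 1" and "\<alpha> = (1 - \<theta>) / 2"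
    and "cadlag_martingale M F T L"
  shows "BMO2_norm M F T (frac_int_process T \<alpha> L)
    \<le> ennreal (3 * (sqrt (2 * \<alpha>) / T powr \<alpha>)) *
      ennreal_sqrt (\<integral>\<^sup>+t\<in>{0..<T}. ennreal ((T - t) powr (- \<theta>)) * (Linf_norm M (L t))\<^sup>2 \<partial>lborel)"
proof -
  interpret stochastic_basis M F T by fact
  have \<alpha>: "0 < \<alpha>" and \<theta>: "- \<theta> = 2 * \<alpha> - 1" using assms by auto
  define b where "b = 3 * (sqrt (2 * \<alpha>) / T powr \<alpha>)"
  define I where "I = (\<integral>\<^sup>+t\<in>{0..<T}. ennreal ((T - t) powr (- \<theta>)) * (Linf_norm M (L t))\<^sup>2 \<partial>lborel)"
  have b0: "0 < b" using \<alpha> T_pos by (simp add: b_def)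
  have "BMO2_norm M F T (frac_int_process T \<alpha> L) \<le> ennreal b * ennreal_sqrt I"
  proof (cases "I = \<infinity>")
    case True
    \<comment> \<open>Positivity of \<open>b\<close> excludes the product of 0 and \<infinity>,
      which is 0 in \<open>ennreal\<close>.\<close>
    then show ?thesis using b0 by (simp add: ennreal_sqrt_def ennreal_mult_top)
  next
    case False
    then obtain i where i: "I = ennreal i" "0 \<le> i" by (cases I) auto
    have fin: "Linf_norm M (L u) \<noteq> \<infinity>" if "0 \<le> u" "u < T" for u
      using Linf_norm_finite[of L "- \<theta>" u] assms(5) False that by (simp add: I_def cadlag_martingale_def)
    define c where "c = b * sqrt i"
    have c0: "0 \<le> c" using b0 i by (simp add: c_def)
    \<comment> \<open>Here the constant 2 is relaxed to 3: 8\<alpha> is the square of 2 times the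
      root of 2\<alpha>, and 18\<alpha> is the square of 3 times that root.\<close>
    have "8 * \<alpha> / (T powr \<alpha>)\<^sup>2 * i \<le> 18 * \<alpha> / (T powr \<alpha>)\<^sup>2 * i"
      using \<alpha> i by (intro mult_right_mono divide_right_mono) auto
    also have "\<dots> = c\<^sup>2"
      using \<alpha> i by (simp add: c_def b_def power_mult_distrib power_divide)
    finally have le: "ennreal (8 * \<alpha> / (T powr \<alpha>)\<^sup>2) * I \<le> ennreal (c\<^sup>2)"
      using i \<alpha> by (simp add: ennreal_mult[symmetric])
    have "BMO2_norm M F T (frac_int_process T \<alpha> L) \<le> ennreal c"
      unfolding BMO2_norm_def
    proof (rule Inf_lower, rule CollectI, intro exI conjI ballI allI impI)
      fix t \<sigma> assume t: "t \<in> {0..<T}" and \<sigma>: "stopping_time F \<sigma> \<and> (\<forall>\<omega>\<in>space M. \<sigma> \<omega> \<in> {0..t})"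
      show "AE \<omega> in M. nn_cond_exp M (pre_sigma \<sigma>) (\<lambda>\<omega>. ennreal (\<bar>frac_int_process T \<alpha> L t \<omega>
          - left_limit (\<lambda>s. frac_int_process T \<alpha> L s \<omega>) (\<sigma> \<omega>)\<bar>\<^sup>2)) \<omega> \<le> ennreal (c\<^sup>2)"
        using t \<sigma> \<alpha> fin le unfolding I_def \<theta>
        by (intro cond_exp_jump_square_le[OF assms(5)]) auto
    qed (rule refl, rule c0)
    also have "ennreal c = ennreal b * ennreal_sqrt I"
      using i b0 by (simp add: c_def ennreal_sqrt_def ennreal_mult)
    finally show ?thesis .
  qed
  then show ?thesis by (simp only: b_def I_def)
qed

end
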